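(* Let $m,n,p,q$ be integers with $0\le m\le q$, $0\le n\le p$, let $a_i,b_j\in\mathbb{C}$ and $\alpha_i,\beta_j>0$ ($1\le i\le p$, $1\le j\le q$), and let $\Delta$, $\delta$ and $H^{m,n}_{p,q}(z)$ be as defined in the context. Assume $$\beta_j(a_i-1-k)\ne\alpha_i(b_j+l)\qquad(i=1,\dots,n;\ j=1,\dots,m;\ k,l\in\mathbb N_0)$$ and $$\alpha_j(1-a_i+k)\ne\alpha_i(1-a_j+l)\qquad(i\ne j;\ i,j=1,\dots,n;\ k,l\in\mathbb N_0),$$ and let either $\Delta<0$, $z\ne0$, or $\Delta=0$, $|z|>\delta$. Then the $H$-function has the power series expansion $$H^{m,n}_{p,q}(z)=\sum_{i=1}^n\sum_{k=0}^\infty h_{ik}\,z^{(a_i-k-1)/\alpha_i},$$ where $$h_{ik}=\frac{(-1)^k}{k!\,\alpha_i}\ \frac{\prod_{j=1}^m\Gamma\!\left(b_j+[1-a_i+k]\frac{\beta_j}{\alpha_i}\right)\prod_{j=1,\,j\ne i}^n\Gamma\!\left(1-a_j-[1-a_i+k]\frac{\alpha_j}{\alpha_i}\right)}{\prod_{j=n+1}^p\Gamma\!\left(a_j+[1-a_i+k]\frac{\alpha_j}{\alpha_i}\right)\prod_{j=m+1}^q\Gamma\!\left(1-b_j-[1-a_i+k]\frac{\beta_j}{\alpha_i}\right)} .$$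
   Context: $\mathbb N_0=\{0,1,2,\dots\}$. Definitions (empty products equal $1$, and $1/\Gamma$ is entire, so $1/\Gamma=0$ at the poles of $\Gamma$): $$\mathcal H(s)=\frac{\prod_{j=1}^m\Gamma(b_j+\beta_js)\ \prod_{i=1}^n\Gamma(1-a_i-\alpha_is)}{\prod_{i=n+1}^p\Gamma(a_i+\alpha_is)\ \prod_{j=m+1}^q\Gamma(1-b_j-\beta_js)},\qquad \Delta=\sum_{j=1}^q\beta_j-\sum_{i=1}^p\alpha_i,\qquad \delta=\prod_{i=1}^p\alpha_i^{-\alpha_i}\prod_{j=1}^q\beta_j^{\beta_j},$$ $$H^{m,n}_{p,q}(z)=\frac1{2\pi i}\int_{\mathfrak L_{+\infty}}\mathcal H(s)z^{-s}\,ds .$$ $\mathfrak L_{+\infty}$ is a loop running from $+\infty+i\varphi_1$ to $+\infty+i\varphi_2$, $\varphi_1<\varphi_2$ (consisting of the half-lines $\operatorname{Im}s=\varphi_1,\varphi_2$ for $\operatorname{Re}s$ sufficiently large), with all poles of $\Gamma(b_j+\beta_js)$ ($1\le j\le m$) to its left (outside the loop) and all poles of $\Gamma(1-a_i-\alpha_is)$ ($1\le i\le n$) to its right (inside the loop). Powers are $z^{c}=\exp(c\log z)$ with one and the same choice of $\log z=\log|z|+i\arg z$ throughout.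
   Formalization: The inner series over k can diverge when poles of different i nearly coincide; the expansion is proved whenever they converge (shown if the poles do not approach exponentially fast), and in general as the limit of sums over poles left of vertical lines staying a fixed distance from the poles. *)

theory Defs
  imports "HOL-Complex_Analysis.Complex_Analysis"
begin

section \<open>Parameters and kernel of the H-function\<close>

definition foxH_Delta :: "nat \<Rightarrow> nat \<Rightarrow> (nat \<Rightarrow> real) \<Rightarrow> (nat \<Rightarrow> real) \<Rightarrow> real" where
  "foxH_Delta p q \<alpha> \<beta> = (\<Sum>j=1..q. \<beta> j) - (\<Sum>i=1..p. \<alpha> i)"

definition foxH_delta :: "nat \<Rightarrow> nat \<Rightarrow> (nat \<Rightarrow> real) \<Rightarrow> (nat \<Rightarrow> real) \<Rightarrow> real" where
  "foxH_delta p q \<alpha> \<beta> = (\<Prod>i=1..p. \<alpha> i powr (- \<alpha> i)) * (\<Prod>j=1..q. \<beta> j powr \<beta> j)"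

text \<open>The Gamma factors of the denominators enter through the entire function \<^const>\<open>rGamma\<close>,
  the reciprocal of the Gamma function, which vanishes at the poles of \<^const>\<open>Gamma\<close>.\<close>

definition foxH_kernel ::
  "nat \<Rightarrow> nat \<Rightarrow> nat \<Rightarrow> nat \<Rightarrow> (nat \<Rightarrow> complex) \<Rightarrow> (nat \<Rightarrow> real) \<Rightarrow> (nat \<Rightarrow> complex) \<Rightarrow>
   (nat \<Rightarrow> real) \<Rightarrow> complex \<Rightarrow> complex" where
  "foxH_kernel m n p q a \<alpha> b \<beta> s =
     (\<Prod>j=1..m. Gamma (b j + of_real (\<beta> j) * s)) *
     (\<Prod>i=1..n. Gamma (1 - a i - of_real (\<alpha> i) * s)) *
     (\<Prod>i=n+1..p. rGamma (a i + of_real (\<alpha> i) * s)) *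
     (\<Prod>j=m+1..q. rGamma (1 - b j - of_real (\<beta> j) * s))"

definition foxH_coeff ::
  "nat \<Rightarrow> nat \<Rightarrow> nat \<Rightarrow> nat \<Rightarrow> (nat \<Rightarrow> complex) \<Rightarrow> (nat \<Rightarrow> real) \<Rightarrow> (nat \<Rightarrow> complex) \<Rightarrow>
   (nat \<Rightarrow> real) \<Rightarrow> nat \<Rightarrow> nat \<Rightarrow> complex" where
  "foxH_coeff m n p q a \<alpha> b \<beta> i k =
     (- 1) ^ k / (fact k * of_real (\<alpha> i)) *
     ((\<Prod>j=1..m. Gamma (b j + (1 - a i + of_nat k) * of_real (\<beta> j / \<alpha> i))) *
      (\<Prod>j\<in>{1..n} - {i}. Gamma (1 - a j - (1 - a i + of_nat k) * of_real (\<alpha> j / \<alpha> i))) *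
      (\<Prod>j=n+1..p. rGamma (a j + (1 - a i + of_nat k) * of_real (\<alpha> j / \<alpha> i))) *
      (\<Prod>j=m+1..q. rGamma (1 - b j - (1 - a i + of_nat k) * of_real (\<beta> j / \<alpha> i))))"


section \<open>Loops starting and ending at positive infinity\<close>

text \<open>A loop is given by a path \<open>g\<close> from \<open>X + i\<phi>\<^sub>1\<close> to \<open>X + i\<phi>\<^sub>2\<close>, preceded by the half-line
  \<open>Im s = \<phi>\<^sub>1\<close>, \<open>Re s \<ge> X\<close> (traversed to the left) and followed by the half-line
  \<open>Im s = \<phi>\<^sub>2\<close>, \<open>Re s \<ge> X\<close> (traversed to the right). The path \<open>loop_trunc \<phi>\<^sub>1 \<phi>\<^sub>2 X g R\<close> is the
  part of the loop obtained by cutting both half-lines at \<open>Re s = R\<close>, and \<open>loop_closed\<close> closes it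
  by the vertical segment on \<open>Re s = R\<close>.\<close>

definition loop_trunc ::
  "real \<Rightarrow> real \<Rightarrow> real \<Rightarrow> (real \<Rightarrow> complex) \<Rightarrow> real \<Rightarrow> real \<Rightarrow> complex" where
  "loop_trunc \<phi>1 \<phi>2 X g R =
     linepath (Complex R \<phi>1) (Complex X \<phi>1) +++ g +++ linepath (Complex X \<phi>2) (Complex R \<phi>2)"

definition loop_closed ::
  "real \<Rightarrow> real \<Rightarrow> real \<Rightarrow> (real \<Rightarrow> complex) \<Rightarrow> real \<Rightarrow> real \<Rightarrow> complex" where
  "loop_closed \<phi>1 \<phi>2 X g R =
     loop_trunc \<phi>1 \<phi>2 X g R +++ linepath (Complex R \<phi>2) (Complex R \<phi>1)"

definition is_loop :: "real \<Rightarrow> real \<Rightarrow> real \<Rightarrow> (real \<Rightarrow> complex) \<Rightarrow> bool" where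
  "is_loop \<phi>1 \<phi>2 X g \<longleftrightarrow>
     \<phi>1 < \<phi>2 \<and> valid_path g \<and> pathstart g = Complex X \<phi>1 \<and> pathfinish g = Complex X \<phi>2 \<and>
     (\<forall>R>X. arc (loop_trunc \<phi>1 \<phi>2 X g R))"

text \<open>The region enclosed by the loop is unbounded, so \<^const>\<open>inside\<close> is applied to the closed
  truncations; a point is inside (outside) the loop if it is inside (outside) all sufficiently long
  ones. In particular it does not lie on the loop.\<close>

definition inside_loop :: "real \<Rightarrow> real \<Rightarrow> real \<Rightarrow> (real \<Rightarrow> complex) \<Rightarrow> complex set" where
  "inside_loop \<phi>1 \<phi>2 X g =
     {w. eventually (\<lambda>R. w \<in> inside (path_image (loop_closed \<phi>1 \<phi>2 X g R))) at_top}"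

definition outside_loop :: "real \<Rightarrow> real \<Rightarrow> real \<Rightarrow> (real \<Rightarrow> complex) \<Rightarrow> complex set" where
  "outside_loop \<phi>1 \<phi>2 X g =
     {w. eventually (\<lambda>R. w \<in> outside (path_image (loop_closed \<phi>1 \<phi>2 X g R))) at_top}"

definition foxH_loop ::
  "nat \<Rightarrow> nat \<Rightarrow> (nat \<Rightarrow> complex) \<Rightarrow> (nat \<Rightarrow> real) \<Rightarrow> (nat \<Rightarrow> complex) \<Rightarrow> (nat \<Rightarrow> real) \<Rightarrow>
   real \<Rightarrow> real \<Rightarrow> real \<Rightarrow> (real \<Rightarrow> complex) \<Rightarrow> bool" where
  "foxH_loop m n a \<alpha> b \<beta> \<phi>1 \<phi>2 X g \<longleftrightarrow>
     is_loop \<phi>1 \<phi>2 X g \<and>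
     (\<forall>j\<in>{1..m}. \<forall>s. b j + of_real (\<beta> j) * s \<in> \<int>\<^sub>\<le>\<^sub>0 \<longrightarrow> s \<in> outside_loop \<phi>1 \<phi>2 X g) \<and>
     (\<forall>i\<in>{1..n}. \<forall>s. 1 - a i - of_real (\<alpha> i) * s \<in> \<int>\<^sub>\<le>\<^sub>0 \<longrightarrow> s \<in> inside_loop \<phi>1 \<phi>2 X g)"

definition loop_integrable ::
  "(complex \<Rightarrow> complex) \<Rightarrow> real \<Rightarrow> real \<Rightarrow> real \<Rightarrow> (real \<Rightarrow> complex) \<Rightarrow> bool" where
  "loop_integrable f \<phi>1 \<phi>2 X g \<longleftrightarrow>
     set_integrable lborel {X..} (\<lambda>x. f (Complex x \<phi>1)) \<and>
     f contour_integrable_on g \<and>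
     set_integrable lborel {X..} (\<lambda>x. f (Complex x \<phi>2))"

definition loop_integral ::
  "(complex \<Rightarrow> complex) \<Rightarrow> real \<Rightarrow> real \<Rightarrow> real \<Rightarrow> (real \<Rightarrow> complex) \<Rightarrow> complex" where
  "loop_integral f \<phi>1 \<phi>2 X g =
     - (LINT x:{X..}|lborel. f (Complex x \<phi>1)) + contour_integral g f +
       (LINT x:{X..}|lborel. f (Complex x \<phi>2))"


section \<open>The H-function\<close>

text \<open>The argument \<open>L\<close> is the chosen value of \<open>log z\<close>, so that \<open>z\<^sup>c\<close> is \<open>exp (c * L)\<close>.\<close>

definition foxH_integrand ::
  "nat \<Rightarrow> nat \<Rightarrow> nat \<Rightarrow> nat \<Rightarrow> (nat \<Rightarrow> complex) \<Rightarrow> (nat \<Rightarrow> real) \<Rightarrow> (nat \<Rightarrow> complex) \<Rightarrow>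
   (nat \<Rightarrow> real) \<Rightarrow> complex \<Rightarrow> complex \<Rightarrow> complex" where
  "foxH_integrand m n p q a \<alpha> b \<beta> L s = foxH_kernel m n p q a \<alpha> b \<beta> s * exp (- s * L)"

definition foxH ::
  "nat \<Rightarrow> nat \<Rightarrow> nat \<Rightarrow> nat \<Rightarrow> (nat \<Rightarrow> complex) \<Rightarrow> (nat \<Rightarrow> real) \<Rightarrow> (nat \<Rightarrow> complex) \<Rightarrow>
   (nat \<Rightarrow> real) \<Rightarrow> real \<Rightarrow> real \<Rightarrow> real \<Rightarrow> (real \<Rightarrow> complex) \<Rightarrow> complex \<Rightarrow> complex" where
  "foxH m n p q a \<alpha> b \<beta> \<phi>1 \<phi>2 X g L =
     1 / (2 * of_real pi * \<i>) * loop_integral (foxH_integrand m n p q a \<alpha> b \<beta> L) \<phi>1 \<phi>2 X g"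

definition foxH_term ::
  "nat \<Rightarrow> nat \<Rightarrow> nat \<Rightarrow> nat \<Rightarrow> (nat \<Rightarrow> complex) \<Rightarrow> (nat \<Rightarrow> real) \<Rightarrow> (nat \<Rightarrow> complex) \<Rightarrow>
   (nat \<Rightarrow> real) \<Rightarrow> complex \<Rightarrow> nat \<Rightarrow> nat \<Rightarrow> complex" where
  "foxH_term m n p q a \<alpha> b \<beta> L i k =
     foxH_coeff m n p q a \<alpha> b \<beta> i k * exp ((a i - of_nat k - 1) / of_real (\<alpha> i) * L)"


section \<open>Convergence of the double series over the poles\<close>

text \<open>The \<open>k\<close>-th pole of \<open>Gamma (1 - a i - \<alpha> i * s)\<close>.\<close>

definition foxH_pole :: "(nat \<Rightarrow> complex) \<Rightarrow> (nat \<Rightarrow> real) \<Rightarrow> nat \<Rightarrow> nat \<Rightarrow> complex" where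
  "foxH_pole a \<alpha> i k = (1 - a i + of_nat k) / of_real (\<alpha> i)"

text \<open>The poles are pairwise different, but poles belonging to different indices \<open>i\<close> may come
  arbitrarily close to each other. The two corresponding terms then are large and nearly cancel, and
  if the poles approach each other fast enough, the series over \<open>k\<close> for a single \<open>i\<close> diverges,
  for every \<open>z\<close>: for example \<open>m = q = 0\<close>, \<open>n = p = 2\<close>, \<open>a 1 = \<alpha> 1 = 1\<close>, \<open>\<alpha> 2 = \<theta>\<close>, \<open>a 2 = 1 + \<theta>\<close>
  with a positive irrational number \<open>\<theta>\<close> satisfying \<open>0 < \<bar>\<theta> * (k + 1) - l\<bar> < exp (- exp k)\<close> for
  infinitely many pairs \<open>k, l\<close>. What always converges are the partial sums over all poles to the left
  of a vertical line, as long as these lines keep a fixed distance from the poles.\<close>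

definition pole_free_abscissas ::
  "nat \<Rightarrow> (nat \<Rightarrow> complex) \<Rightarrow> (nat \<Rightarrow> real) \<Rightarrow> real \<Rightarrow> (nat \<Rightarrow> real) \<Rightarrow> bool" where
  "pole_free_abscissas n a \<alpha> \<epsilon> R \<longleftrightarrow>
     filterlim R at_top sequentially \<and>
     (\<forall>N. \<forall>i\<in>{1..n}. \<forall>k. \<epsilon> \<le> \<bar>R N - Re (foxH_pole a \<alpha> i k)\<bar>)"

definition sums_over_poles ::
  "nat \<Rightarrow> (nat \<Rightarrow> complex) \<Rightarrow> (nat \<Rightarrow> real) \<Rightarrow> (nat \<Rightarrow> nat \<Rightarrow> complex) \<Rightarrow> complex \<Rightarrow> bool" where
  "sums_over_poles n a \<alpha> t S \<longleftrightarrow>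
     (\<exists>\<epsilon>>0. \<exists>R. pole_free_abscissas n a \<alpha> \<epsilon> R) \<and>
     (\<forall>\<epsilon>>0. \<forall>R. pole_free_abscissas n a \<alpha> \<epsilon> R \<longrightarrow>
        (\<lambda>N. \<Sum>i=1..n. \<Sum>k | Re (foxH_pole a \<alpha> i k) < R N. t i k) \<longlonglongrightarrow> S)"

text \<open>Poles belonging to different indices do not approach each other exponentially fast.\<close>

definition poles_separated :: "nat \<Rightarrow> (nat \<Rightarrow> complex) \<Rightarrow> (nat \<Rightarrow> real) \<Rightarrow> bool" where
  "poles_separated n a \<alpha> \<longleftrightarrow>
     (\<forall>c>0. \<exists>C>0. \<forall>i\<in>{1..n}. \<forall>j\<in>{1..n}. \<forall>k l. i \<noteq> j \<longrightarrow>
        C * exp (- c * real k) \<le> dist (foxH_pole a \<alpha> i k) (foxH_pole a \<alpha> j l))"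

end

theory Submission
  imports Defs "HOL-Real_Asymp.Real_Asymp"
begin

text \<open>By the reflection formula, \<open>\<Gamma>(1 - w) = \<pi> / (\<Gamma>(w) sin \<pi>w)\<close> and \<open>1 / \<Gamma>(1 - w) = \<Gamma>(w) sin (\<pi>w) / \<pi>\<close>,
  the integrand is the product of \<open>\<Prod>\<^sub>j \<Gamma>(b\<^sub>j + \<beta>\<^sub>js) / \<Prod>\<^sub>i \<Gamma>(a\<^sub>i + \<alpha>\<^sub>is) \<sqdot> z\<^sup>-\<^sup>s\<close> (all \<open>j \<le> q\<close>, \<open>i \<le> p\<close>), of sines that are
  bounded on horizontal strips, and of \<open>n\<close> cosecants. A crude form of Stirling's formula shows that the
  first factor has the size \<open>exp (\<Delta> x ln x + (ln \<delta> - \<Delta> - ln |z|) x + o(x))\<close> for \<open>x = Re s\<close>, so it decays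
  exponentially, and \<open>|sin \<pi>w|\<close> is at least the distance of \<open>w\<close> to the nearest integer. Hence the
  integrand decays along the two half-lines and on vertical segments that keep away from the poles. The
  residue theorem for the truncated loop, which winds clockwise around the enclosed poles, gives the
  partial sums. The term at a pole has the same shape with one cosecant replaced by \<open>\<plusminus>1 / \<alpha>\<^sub>i\<close>, so if the
  poles are separated, the remaining \<open>n - 1\<close> cosecants cannot destroy the exponential decay.\<close>

section \<open>Bounds for the Gamma function on horizontal strips\<close>

lemma norm_pochhammer_ge:
  fixes z :: complex
  assumes "Re z \<ge> 0"
  shows "pochhammer (Re z) n \<le> norm (pochhammer z n)"
proof -
  have "Re z + real i \<le> norm (z + of_nat i)" for i
    using complex_Re_le_cmod[of "z + of_nat i"] by simp
  then show ?thesis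
    unfolding pochhammer_prod prod_norm[symmetric] using assms by (intro prod_mono) auto
qed

text \<open>Telescoping: \<open>1/(n+2)^2 \<le> 1/(n+1) - 1/(n+2)\<close>. What matters later is the
  bound 2, which does not depend on \<open>n\<close>.\<close>

lemma sum_inverse_squares_le: "(\<Sum>i=0..n. 1 / (real i + 1)^2) \<le> 2 - 1 / (real n + 1)"
proof (induction n)
  case (Suc n)
  have "1 / (real n + 2)^2 \<le> 1 / (real n + 1) - 1 / (real n + 2)"
    by (simp add: divide_simps power2_eq_square)
  then show ?case using Suc by (simp add: algebra_simps)
qed simp

text \<open>With \<open>u = Re z + i\<close>, one has
  \<open>|z + i|^2 = u^2 (1 + (Im z)^2 / u^2)\<close>, and \<open>1 + t \<le> exp t\<close> turns
  the excess into an exponential. Since \<open>u \<ge> i + 1\<close>, the exponents are summable, so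
  the loss is uniform in \<open>n\<close> and survives the limit in the product formula for
  \<open>rGamma\<close>.\<close>

lemma norm_pochhammer_le:
  fixes z :: complex
  assumes "Re z \<ge> 1"
  shows "norm (pochhammer z (Suc n)) \<le> exp ((Im z)^2) * pochhammer (Re z) (Suc n)"
proof -
  have *: "norm (z + of_nat i) \<le> exp ((Im z)^2 / 2 * (1 / (real i + 1)^2)) * (Re z + of_nat i)" for i
  proof -
    define u where "u = Re z + real i"
    have u: "u \<ge> real i + 1" using assms by (simp add: u_def)
    then have u0: "u > 0" by linarith
    have "(norm (z + of_nat i))^2 = u^2 + (Im z)^2"
      by (simp add: cmod_power2 u_def)
    also have "\<dots> = u^2 * (1 + (Im z)^2 / u^2)"
      using u0 by (simp add: field_simps)
    also have "\<dots> \<le> u^2 * exp ((Im z)^2 / u^2)"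
      by (intro mult_left_mono exp_ge_add_one_self) auto
    also have "\<dots> \<le> u^2 * exp ((Im z)^2 / (real i + 1)^2)"
      using u by (intro mult_left_mono) (auto intro!: divide_left_mono power_mono mult_pos_pos zero_less_power)
    also have "\<dots> = (exp ((Im z)^2 / 2 * (1 / (real i + 1)^2)) * u)^2"
      by (simp add: power_mult_distrib exp_double[symmetric])
    finally show ?thesis unfolding u_def
      by (rule power2_le_imp_le) (use assms in auto)
  qed
  have "norm (pochhammer z (Suc n)) \<le>
      (\<Prod>i=0..n. exp ((Im z)^2 / 2 * (1 / (real i + 1)^2)) * (Re z + of_nat i))"
    unfolding pochhammer_Suc_prod prod_norm[symmetric] using * by (intro prod_mono) auto
  also have "\<dots> = exp ((Im z)^2 / 2 * (\<Sum>i=0..n. 1 / (real i + 1)^2)) * pochhammer (Re z) (Suc n)"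
    by (simp add: prod.distrib pochhammer_Suc_prod exp_sum sum_distrib_left)
  also have "\<dots> \<le> exp ((Im z)^2 / 2 * 2) * pochhammer (Re z) (Suc n)"
    using sum_inverse_squares_le[of n] assms
    by (intro mult_right_mono) (auto intro!: mult_left_mono pochhammer_nonneg
         intro: order_trans[OF sum_inverse_squares_le])
  finally show ?thesis by simp
qed

text \<open>In Gauss's product formula the modulus of the numerator depends on \<open>Re z\<close>
  only, and \<open>norm_pochhammer_ge\<close> compares the denominators; the inequality passes to
  the limit.\<close>

lemma norm_Gamma_le_Gamma_Re:
  fixes z :: complex
  assumes "Re z > 0"
  shows "norm (Gamma z) \<le> Gamma (Re z)"
proof (rule tendsto_le[OF _ Gamma_series_LIMSEQ tendsto_norm[OF Gamma_series_LIMSEQ]])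
  have "norm (Gamma_series z n) \<le> Gamma_series (Re z) n" for n
    unfolding Gamma_series_def using norm_pochhammer_ge[of z "n+1"] assms
    by (auto simp: norm_divide norm_mult intro!: divide_left_mono mult_pos_pos pochhammer_pos
      intro: less_le_trans[OF pochhammer_pos])
  then show "\<forall>\<^sub>F n in sequentially. norm (Gamma_series z n) \<le> Gamma_series (Re z) n"
    by simp
qed auto

text \<open>The counterpart for the reciprocal, again from the product formula. The price is a
  factor that is bounded on horizontal strips.\<close>

lemma norm_rGamma_le_rGamma_Re:
  fixes z :: complex
  assumes "Re z \<ge> 1"
  shows "norm (rGamma z) \<le> exp ((Im z)^2) * rGamma (Re z)"
proof (rule tendsto_le[OF _ tendsto_mult[OF tendsto_const rGamma_series_LIMSEQ]
          tendsto_norm[OF rGamma_series_LIMSEQ]])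
  have "norm (rGamma_series z n) \<le> exp ((Im z)^2) * rGamma_series (Re z) n" for n
    unfolding rGamma_series_def using norm_pochhammer_le[of z "n"] assms
    by (simp add: norm_divide norm_mult divide_right_mono)
  then show "\<forall>\<^sub>F n in sequentially. norm (rGamma_series z n) \<le> exp ((Im z)^2) * rGamma_series (Re z) n"
    by simp
qed auto

section \<open>Stirling-type bounds for real arguments\<close>

lemma Digamma_le_ln:
  fixes x :: real
  assumes "x > 0"
  shows "Digamma x \<le> ln x" "ln x \<le> Digamma (x + 1)"
proof -
  \<comment> \<open>By the functional equation the increment of \<open>ln_Gamma\<close> over
    \<open>[x, x+1]\<close> is \<open>ln x\<close>; by the mean value theorem it is a value of the
    increasing function \<open>Digamma\<close> in between.\<close>
  have "\<exists>y>x. y < x + 1 \<and> ln_Gamma (x+1) - ln_Gamma x = (x + 1 - x) * Digamma y"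
    using assms by (intro MVT2) (auto intro!: derivative_eq_intros)
  then obtain y where y: "x < y" "y < x+1" "ln_Gamma (x+1) - ln_Gamma x = Digamma y"
    by auto
  have "ln_Gamma (x+1) - ln_Gamma x = ln x"
  proof -
    have "x \<notin> \<int>\<^sub>\<le>\<^sub>0" using assms by (auto elim!: nonpos_Ints_cases)
    then show ?thesis
      using assms Gamma_plus1[of x] by (simp add: ln_Gamma_real_pos ln_mult_pos)
  qed
  then show "Digamma x \<le> ln x" "ln x \<le> Digamma (x + 1)"
    using y Digamma_real_mono[of x y] Digamma_real_mono[of y "x+1"] assms by auto
qed

text \<open>The right-hand side is the antiderivative of \<open>ln\<close> that vanishes at 1, as
  \<open>ln_Gamma\<close> does, and \<open>Digamma \<le> ln\<close>.\<close>

lemma ln_Gamma_real_le: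
  fixes x :: real
  assumes "x \<ge> 1"
  shows "ln_Gamma x \<le> x * ln x - x + 1"
proof -
  define f where "f = (\<lambda>x::real. x * ln x - x + 1 - ln_Gamma x)"
  have "f 1 \<le> f x"
    using assms
  proof (rule DERIV_nonneg_imp_nondecreasing)
    fix y :: real assume y: "1 \<le> y"
    have "(f has_real_derivative (ln y - Digamma y)) (at y)"
      unfolding f_def using y by (auto intro!: derivative_eq_intros)
    moreover have "ln y - Digamma y \<ge> 0"
      using Digamma_le_ln(1)[of y] y by simp
    ultimately show "\<exists>l. (f has_real_derivative l) (at y) \<and> 0 \<le> l" by blast
  qed
  moreover have "f 1 = 0" by (simp add: f_def ln_Gamma_real_pos)
  ultimately show ?thesis by (simp add: f_def)
qed

text \<open>The same comparison started at 2, where both sides vanish. The shift by 1 comes from the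
  lower bound \<open>ln (y - 1) \<le> Digamma y\<close>.\<close>

lemma ln_Gamma_real_ge:
  fixes x :: real
  assumes "x \<ge> 2"
  shows "ln_Gamma x \<ge> (x - 1) * ln (x - 1) - (x - 1) + 1"
proof -
  define f where "f = (\<lambda>x::real. ln_Gamma x - ((x - 1) * ln (x - 1) - (x - 1) + 1))"
  have "f 2 \<le> f x"
    using assms
  proof (rule DERIV_nonneg_imp_nondecreasing)
    fix y :: real assume y: "2 \<le> y"
    have "(f has_real_derivative (Digamma y - ln (y - 1))) (at y)"
      unfolding f_def using y by (auto intro!: derivative_eq_intros)
    moreover have "Digamma y - ln (y - 1) \<ge> 0"
      using Digamma_le_ln(2)[of "y - 1"] y by simp
    ultimately show "\<exists>l. (f has_real_derivative l) (at y) \<and> 0 \<le> l" by blast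
  qed
  moreover have "f 2 = 0" using Gamma_plus1[of "1::real"] by (simp add: f_def ln_Gamma_real_pos)
  ultimately show ?thesis by (simp add: f_def)
qed

section \<open>Exponential bounds for the Gamma factors on strips\<close>

lemma stirling_main_term:
  fixes \<beta> r :: real
  assumes "\<beta> > 0"
  shows "((\<lambda>x. ((\<beta>*x+r) * ln (\<beta>*x+r) - (\<beta>*x+r) + 1 - \<beta> * x * ln x - (\<beta> * ln \<beta> - \<beta>) * x) / x) \<longlongrightarrow> 0) at_top"
  using assms by real_asymp

text \<open>By \<open>stirling_main_term\<close>, the shift by \<open>Re b\<close> and the additive
  constant change the exponent by \<open>o(x)\<close> only, which \<open>\<eta> * x\<close>
  absorbs.\<close>

lemma eventually_norm_Gamma_le:
  fixes b :: complex and \<beta> \<eta> :: real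
  assumes "\<beta> > 0" "\<eta> > 0"
  shows "\<forall>\<^sub>F x in at_top. \<forall>s. Re s = x \<longrightarrow>
           norm (Gamma (b + of_real \<beta> * s)) \<le> exp (\<beta> * x * ln x + (\<beta> * ln \<beta> - \<beta> + \<eta>) * x)"
proof -
  have "\<forall>\<^sub>F x in at_top. \<beta> * x + Re b \<ge> 1"
    using assms by real_asymp
  moreover have "\<forall>\<^sub>F x in at_top. x > (0::real)" by (rule eventually_gt_at_top)
  moreover note order_tendstoD(2)[OF stirling_main_term[OF \<open>\<beta> > 0\<close>, of "Re b"] \<open>\<eta> > 0\<close>]
  ultimately show ?thesis
  proof eventually_elim
    case (elim x)
    show ?case
    proof (intro allI impI)
      fix s :: complex assume s: "Re s = x"
      define u where "u = \<beta> * x + Re b"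
      have "norm (Gamma (b + of_real \<beta> * s)) \<le> Gamma u"
        using norm_Gamma_le_Gamma_Re[of "b + of_real \<beta> * s"] elim s by (simp add: u_def add.commute)
      also have "\<dots> = exp (ln_Gamma u)" using elim by (simp add: u_def Gamma_real_pos_exp)
      also have "\<dots> \<le> exp (u * ln u - u + 1)"
        using ln_Gamma_real_le[of u] elim by (simp add: u_def)
      also have "\<dots> \<le> exp (\<beta> * x * ln x + (\<beta> * ln \<beta> - \<beta> + \<eta>) * x)"
        using elim(2,3) by (simp add: u_def field_simps)
      finally show "norm (Gamma (b + of_real \<beta> * s)) \<le> exp (\<beta> * x * ln x + (\<beta> * ln \<beta> - \<beta> + \<eta>) * x)" .
    qed
  qed
qed

lemma eventually_norm_rGamma_le:
  fixes a :: complex and \<alpha> M \<eta> :: real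
  assumes "\<alpha> > 0" "\<eta> > 0"
  shows "\<forall>\<^sub>F x in at_top. \<forall>s. Re s = x \<longrightarrow> \<bar>Im s\<bar> \<le> M \<longrightarrow>
           norm (rGamma (a + of_real \<alpha> * s)) \<le> exp (- \<alpha> * x * ln x - (\<alpha> * ln \<alpha> - \<alpha> - \<eta>) * x)"
proof -
  \<comment> \<open>Bounds the squared imaginary part of the argument on the strip; being constant,
    it is also \<open>o(x)\<close>.\<close>
  define D where "D = (\<bar>Im a\<bar> + \<alpha> * M)\<^sup>2"
  have "((\<lambda>x. D / x - ((\<alpha>*x+(Re a - 1)) * ln (\<alpha>*x+(Re a - 1)) - (\<alpha>*x+(Re a - 1)) + 1
        - \<alpha> * x * ln x - (\<alpha> * ln \<alpha> - \<alpha>) * x) / x) \<longlongrightarrow> 0 - 0) at_top"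
    by (intro tendsto_diff stirling_main_term assms) real_asymp
  then have "\<forall>\<^sub>F x in at_top. D / x - ((\<alpha>*x+(Re a - 1)) * ln (\<alpha>*x+(Re a - 1)) - (\<alpha>*x+(Re a - 1)) + 1
        - \<alpha> * x * ln x - (\<alpha> * ln \<alpha> - \<alpha>) * x) / x < \<eta>"
    using order_tendstoD(2) assms by fastforce
  moreover have "\<forall>\<^sub>F x in at_top. \<alpha> * x + Re a \<ge> 2"
    using assms by real_asymp
  moreover have "\<forall>\<^sub>F x in at_top. x > (0::real)" by (rule eventually_gt_at_top)
  ultimately show ?thesis
  proof eventually_elim
    case (elim x)
    show ?case
    proof (intro allI impI)
      fix s :: complex assume s: "Re s = x" "\<bar>Im s\<bar> \<le> M"
      define u where "u = \<alpha> * x + Re a"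
      have "\<bar>Im (a + of_real \<alpha> * s)\<bar> \<le> \<bar>Im a\<bar> + \<alpha> * M"
        using s assms by (auto intro!: abs_triangle_ineq[THEN order_trans] simp: abs_mult)
      then have "(Im (a + of_real \<alpha> * s))\<^sup>2 \<le> D"
        unfolding D_def by (metis abs_ge_zero power2_abs power_mono)
      have "norm (rGamma (a + of_real \<alpha> * s)) \<le> exp ((Im (a + of_real \<alpha> * s))\<^sup>2) * rGamma u"
        using norm_rGamma_le_rGamma_Re[of "a + of_real \<alpha> * s"] elim s by (simp add: u_def add.commute)
      also have "rGamma u = exp (- ln_Gamma u)"
        using elim by (simp add: u_def rGamma_inverse_Gamma Gamma_real_pos_exp exp_minus)
      also have "exp ((Im (a + of_real \<alpha> * s))\<^sup>2) * \<dots> \<le> exp D * exp (- ((u - 1) * ln (u - 1) - (u - 1) + 1))"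
        using ln_Gamma_real_ge[of u] elim \<open>_ \<le> D\<close> by (intro mult_mono) (auto simp: u_def)
      also have "\<dots> = exp (D - ((u - 1) * ln (u - 1) - (u - 1) + 1))"
        by (simp add: mult_exp_exp)
      also have "\<dots> \<le> exp (- \<alpha> * x * ln x - (\<alpha> * ln \<alpha> - \<alpha> - \<eta>) * x)"
        using elim(1,3) by (simp add: u_def field_simps)
      finally show "norm (rGamma (a + of_real \<alpha> * s)) \<le> exp (- \<alpha> * x * ln x - (\<alpha> * ln \<alpha> - \<alpha> - \<eta>) * x)" .
    qed
  qed
qed

text \<open>What remains of the integrand once the sines and cosecants of the reflection formula are
  split off. All \<open>q\<close> and all \<open>p\<close> parameters enter alike, irrespective of
  \<open>m\<close> and \<open>n\<close>, so its growth is governed by \<Delta> and \<delta>.\<close>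

definition foxH_gammas ::
  "nat \<Rightarrow> nat \<Rightarrow> (nat \<Rightarrow> complex) \<Rightarrow> (nat \<Rightarrow> real) \<Rightarrow> (nat \<Rightarrow> complex) \<Rightarrow> (nat \<Rightarrow> real) \<Rightarrow>
   complex \<Rightarrow> complex \<Rightarrow> complex" where
  "foxH_gammas p q a \<alpha> b \<beta> L s =
     (\<Prod>j=1..q. Gamma (b j + of_real (\<beta> j) * s)) *
     (\<Prod>i=1..p. rGamma (a i + of_real (\<alpha> i) * s)) * exp (- s * L)"

lemma norm_foxH_gammas_le:
  fixes a b :: "nat \<Rightarrow> complex" and \<alpha> \<beta> :: "nat \<Rightarrow> real" and L :: complex
  assumes \<alpha>: "\<And>i. i \<in> {1..p} \<Longrightarrow> \<alpha> i > 0"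
    and \<beta>: "\<And>j. j \<in> {1..q} \<Longrightarrow> \<beta> j > 0"
    and conv: "foxH_Delta p q \<alpha> \<beta> < 0 \<or>
           foxH_Delta p q \<alpha> \<beta> = 0 \<and> norm (exp L) > foxH_delta p q \<alpha> \<beta>"
  obtains c x0 where "c > 0"
    "\<And>s. Re s \<ge> x0 \<Longrightarrow> \<bar>Im s\<bar> \<le> M \<Longrightarrow> norm (foxH_gammas p q a \<alpha> b \<beta> L s) \<le> exp (- c * Re s)"
proof -
  define \<Delta> where "\<Delta> = foxH_Delta p q \<alpha> \<beta>"
  define l\<delta> where "l\<delta> = (\<Sum>j=1..q. \<beta> j * ln (\<beta> j)) - (\<Sum>i=1..p. \<alpha> i * ln (\<alpha> i))"
  have l\<delta>: "foxH_delta p q \<alpha> \<beta> = exp l\<delta>"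
  proof -
    have "(\<Prod>i=1..p. \<alpha> i powr (- \<alpha> i)) = (\<Prod>i=1..p. exp (- (\<alpha> i * ln (\<alpha> i))))"
      using \<alpha> by (intro prod.cong refl) (force simp: powr_def)
    moreover have "(\<Prod>j=1..q. \<beta> j powr \<beta> j) = (\<Prod>j=1..q. exp (\<beta> j * ln (\<beta> j)))"
      using \<beta> by (intro prod.cong refl) (force simp: powr_def)
    ultimately show ?thesis
      by (simp add: foxH_delta_def l\<delta>_def exp_sum[symmetric] mult_exp_exp sum_negf)
  qed
  \<comment> \<open>The exponent of the final bound: each of the \<open>p + q\<close> Gamma factors
    contributes an error \<open>\<eta> * x\<close>, and the last term accounts for the imaginary
    part of \<open>L\<close>.\<close>
  define E :: "real \<Rightarrow> real \<Rightarrow> real" where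
    "E \<eta> x = \<Delta> * x * ln x + (l\<delta> - \<Delta> - Re L + real (p + q) * \<eta>) * x + \<bar>Im L\<bar> * M" for \<eta> x
  have "\<exists>\<eta>>0. \<exists>c>0. \<forall>\<^sub>F x in at_top. E \<eta> x \<le> - c * x"
  proof (cases "\<Delta> < 0")
    case True
    \<comment> \<open>Here \<open>\<Delta> * x * ln x\<close> beats every linear term, so any \<eta>
      and any rate will do.\<close>
    then have "\<forall>\<^sub>F x in at_top. E 1 x \<le> - 1 * x" unfolding E_def by real_asymp
    then show ?thesis by (intro exI[of _ 1] conjI) auto
  next
    case False
    define \<kappa> where "\<kappa> = Re L - l\<delta>"
    \<comment> \<open>\<open>\<kappa>\<close> is \<open>ln (|z| / \<delta>)\<close>. The errors
      together take at most half of it; the part between \<open>\<kappa>/2\<close> and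
      \<open>\<kappa>/4\<close> absorbs the constant term of \<open>E\<close>.\<close>
    define \<eta> where "\<eta> = \<kappa> / (2 * (real (p + q) + 1))"
    from False conv have "\<Delta> = 0" "\<kappa> > 0" by (auto simp: \<Delta>_def l\<delta> \<kappa>_def)
    have "\<eta> > 0" using \<open>\<kappa> > 0\<close> unfolding \<eta>_def by (intro divide_pos_pos) auto
    have "real (p + q) * \<eta> \<le> \<kappa> / 2"
      using \<open>\<kappa> > 0\<close> by (simp add: \<eta>_def divide_simps)
    moreover have "l\<delta> - Re L = - \<kappa>" by (simp add: \<kappa>_def)
    ultimately have "l\<delta> - Re L + real (p + q) * \<eta> < - (\<kappa> / 4)" using \<open>\<kappa> > 0\<close> by linarith
    then have "\<forall>\<^sub>F x in at_top. (l\<delta> - Re L + real (p + q) * \<eta>) * x + \<bar>Im L\<bar> * M \<le> - (\<kappa> / 4) * x"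
      by real_asymp
    then have "\<forall>\<^sub>F x in at_top. E \<eta> x \<le> - (\<kappa> / 4) * x" using \<open>\<Delta> = 0\<close> by (simp add: E_def)
    then show ?thesis using \<open>\<eta> > 0\<close> \<open>\<kappa> > 0\<close>
      by (intro exI[of _ \<eta>] exI[of _ "\<kappa> / 4"] conjI) auto
  qed
  then obtain \<eta> c where \<eta>: "\<eta> > 0" and c: "c > 0" "\<forall>\<^sub>F x in at_top. E \<eta> x \<le> - c * x" by blast
  have "\<forall>\<^sub>F x in at_top. \<forall>j\<in>{1..q}. \<forall>s. Re s = x \<longrightarrow>
           norm (Gamma (b j + of_real (\<beta> j) * s)) \<le> exp (\<beta> j * x * ln x + (\<beta> j * ln (\<beta> j) - \<beta> j + \<eta>) * x)"
    using \<beta> \<eta> by (intro eventually_ball_finite ballI eventually_norm_Gamma_le) auto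
  moreover have "\<forall>\<^sub>F x in at_top. \<forall>i\<in>{1..p}. \<forall>s. Re s = x \<longrightarrow> \<bar>Im s\<bar> \<le> M \<longrightarrow>
           norm (rGamma (a i + of_real (\<alpha> i) * s)) \<le> exp (- \<alpha> i * x * ln x - (\<alpha> i * ln (\<alpha> i) - \<alpha> i - \<eta>) * x)"
    using \<alpha> \<eta> by (intro eventually_ball_finite ballI eventually_norm_rGamma_le) auto
  ultimately have "\<forall>\<^sub>F x in at_top. \<forall>s. Re s = x \<longrightarrow> \<bar>Im s\<bar> \<le> M \<longrightarrow>
      norm (foxH_gammas p q a \<alpha> b \<beta> L s) \<le> exp (- c * x)"
    using c(2)
  proof eventually_elim
    case (elim x)
    show ?case
    proof (intro allI impI)
      fix s :: complex assume s: "Re s = x" "\<bar>Im s\<bar> \<le> M"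
      have 1: "norm (\<Prod>j=1..q. Gamma (b j + of_real (\<beta> j) * s)) \<le>
          exp (\<Sum>j=1..q. \<beta> j * x * ln x + (\<beta> j * ln (\<beta> j) - \<beta> j + \<eta>) * x)"
        unfolding exp_sum[OF finite_atLeastAtMost] prod_norm[symmetric]
        using elim(1) s by (intro prod_mono) auto
      have 2: "norm (\<Prod>i=1..p. rGamma (a i + of_real (\<alpha> i) * s)) \<le>
          exp (\<Sum>i=1..p. - \<alpha> i * x * ln x - (\<alpha> i * ln (\<alpha> i) - \<alpha> i - \<eta>) * x)"
        unfolding exp_sum[OF finite_atLeastAtMost] prod_norm[symmetric]
        using elim(2) s by (intro prod_mono) auto
      have "Im s * Im L \<le> \<bar>Im s\<bar> * \<bar>Im L\<bar>" by (simp flip: abs_mult)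
      also have "\<dots> \<le> M * \<bar>Im L\<bar>" using s by (intro mult_right_mono) auto
      finally have "Re (- s * L) \<le> - Re L * x + \<bar>Im L\<bar> * M"
        using s by (simp add: mult.commute)
      then have 3: "norm (exp (- s * L)) \<le> exp (- Re L * x + \<bar>Im L\<bar> * M)"
        unfolding norm_exp_eq_Re by simp
      have 4: "(\<Sum>j=1..q. \<beta> j * x * ln x + (\<beta> j * ln (\<beta> j) - \<beta> j + \<eta>) * x) =
          (\<Sum>j=1..q. \<beta> j) * x * ln x + ((\<Sum>j=1..q. \<beta> j * ln (\<beta> j)) - (\<Sum>j=1..q. \<beta> j) + real q * \<eta>) * x"
        by (simp add: sum.distrib sum_subtractf flip: sum_distrib_right)
      have 5: "(\<Sum>i=1..p. - \<alpha> i * x * ln x - (\<alpha> i * ln (\<alpha> i) - \<alpha> i - \<eta>) * x) =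
          - (\<Sum>i=1..p. \<alpha> i) * x * ln x - ((\<Sum>i=1..p. \<alpha> i * ln (\<alpha> i)) - (\<Sum>i=1..p. \<alpha> i) - real p * \<eta>) * x"
        by (simp add: sum.distrib sum_subtractf sum_negf flip: sum_distrib_right)
      have "norm (foxH_gammas p q a \<alpha> b \<beta> L s) \<le>
          exp (\<Sum>j=1..q. \<beta> j * x * ln x + (\<beta> j * ln (\<beta> j) - \<beta> j + \<eta>) * x) *
          exp (\<Sum>i=1..p. - \<alpha> i * x * ln x - (\<alpha> i * ln (\<alpha> i) - \<alpha> i - \<eta>) * x) *
          exp (- Re L * x + \<bar>Im L\<bar> * M)"
        unfolding foxH_gammas_def norm_mult using 1 2 3 by (intro mult_mono) auto
      also have "\<dots> = exp (E \<eta> x)"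
        unfolding 4 5 mult_exp_exp E_def \<Delta>_def foxH_Delta_def l\<delta>_def of_nat_add
        by (rule arg_cong[where f = exp]) algebra
      also have "\<dots> \<le> exp (- c * x)" using elim(3) by simp
      finally show "norm (foxH_gammas p q a \<alpha> b \<beta> L s) \<le> exp (- c * x)" .
    qed
  qed
  then obtain x0 where "\<forall>x\<ge>x0. \<forall>s. Re s = x \<longrightarrow> \<bar>Im s\<bar> \<le> M \<longrightarrow>
      norm (foxH_gammas p q a \<alpha> b \<beta> L s) \<le> exp (- c * x)"
    by (auto simp: eventually_at_top_linorder)
  then show ?thesis using that[of c x0] c(1) by auto
qed

section \<open>Bounds for the sine and the reflection formula\<close>

text \<open>Jordan's inequality: sine is concave on \<open>[0, pi]\<close> and hence lies above its
  chord from 0 to \<open>pi/2\<close>.\<close>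

lemma sin_ge_two_over_pi:
  fixes x :: real
  assumes "0 \<le> x" "x \<le> pi / 2"
  shows "2 / pi * x \<le> sin x"
proof -
  have "convex_on {0..pi} (\<lambda>x::real. - sin x)"
    by (rule f''_ge0_imp_convex[where f' = "\<lambda>x. - cos x" and f'' = sin])
       (auto intro!: derivative_eq_intros sin_ge_zero)
  then have "- sin ((1 - t) *\<^sub>R 0 + t *\<^sub>R (pi / 2)) \<le> (1 - t) * - sin 0 + t * - sin (pi / 2)"
    if "0 \<le> t" "t \<le> 1" for t
    using that by (rule convex_onD) auto
  from this[of "2 / pi * x"] show ?thesis using assms by (simp add: divide_simps)
qed

lemma abs_sin_ge_two_over_pi:
  fixes x :: real
  assumes "\<bar>x\<bar> \<le> pi / 2"
  shows "2 / pi * \<bar>x\<bar> \<le> \<bar>sin x\<bar>"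
proof -
  have "2 / pi * \<bar>x\<bar> \<le> sin \<bar>x\<bar>" using assms by (intro sin_ge_two_over_pi) auto
  also have "\<dots> \<le> \<bar>sin x\<bar>" by (simp add: abs_if split: if_splits)
  finally show ?thesis .
qed

text \<open>The last summand is \<open>sinh^2 (Im z)\<close>, so the real and imaginary distances to
  a zero can be estimated separately.\<close>

lemma norm_sin_squared_alt: "(norm (sin z))\<^sup>2 = (sin (Re z))\<^sup>2 + (exp (Im z) - exp (- Im z))\<^sup>2 / 4"
proof -
  have 1: "exp (2 * Im z) = (exp (Im z))\<^sup>2" "inverse ((exp (Im z))\<^sup>2) = (exp (- Im z))\<^sup>2"
    by (simp_all add: exp_double[symmetric] exp_minus power_inverse)
  have "exp (Im z) * exp (- Im z) = 1" by (simp add: mult_exp_exp)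
  then have "(exp (Im z) - exp (- Im z))\<^sup>2 = (exp (Im z))\<^sup>2 + (exp (- Im z))\<^sup>2 - 2"
    by (simp add: power2_diff mult.assoc)
  then show ?thesis unfolding norm_sin_squared cos_double_sin 1 by simp
qed

lemma abs_le_abs_exp_minus_exp: "\<bar>y\<bar> \<le> \<bar>exp y - exp (- y)\<bar>" for y :: real
proof -
  have "y \<le> exp y - exp (- y)" if "y \<ge> 0" for y :: real
  proof -
    have "exp (- y) \<le> 1" using that by simp
    then show ?thesis using exp_ge_add_one_self[of y] by linarith
  qed
  from this[of y] this[of "-y"] show ?thesis by (cases "y \<ge> 0") auto
qed

text \<open>By periodicity \<open>w\<close> may be replaced by \<open>t = w - N\<close> with
  \<open>|Re t| \<le> 1/2\<close>. Jordan's inequality handles the real part; for the imaginary part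
  the crude bound \<open>|2 sinh y| \<ge> |y|\<close> suffices because
  \<open>pi \<ge> 2\<close>.\<close>

lemma norm_sin_pi_ge: "norm (w - of_int (round (Re w))) \<le> norm (sin (of_real pi * w))"
proof -
  define N where "N = round (Re w)"
  define t where "t = w - of_int N"
  have t: "\<bar>Re t\<bar> \<le> 1 / 2" using of_int_round_abs_le[of "Re w"] by (simp add: t_def N_def abs_minus_commute)
  have "sin (of_real pi * w) = sin (of_real pi * t + of_int N * of_real pi)"
    by (simp add: t_def algebra_simps)
  also have "norm \<dots> = norm (sin (of_real pi * t))"
  proof -
    have "complex_of_int N * of_real pi = of_real (pi * of_int N)" by simp
    then have "norm (cos (complex_of_int N * of_real pi)) = 1" "sin (complex_of_int N * of_real pi) = 0"
      by (simp_all only: cos_of_real sin_of_real cos_npi_int sin_npi_int) auto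
    then show ?thesis unfolding sin_add by (simp add: norm_mult)
  qed
  finally have "(norm (sin (of_real pi * w)))\<^sup>2 = (sin (pi * Re t))\<^sup>2 + (exp (pi * Im t) - exp (- (pi * Im t)))\<^sup>2 / 4"
    by (simp add: norm_sin_squared_alt)
  also have "\<dots> \<ge> (2 / pi * \<bar>pi * Re t\<bar>)\<^sup>2 + (pi * Im t)\<^sup>2 / 4"
  proof (intro add_mono divide_right_mono)
    have "2 / pi * \<bar>pi * Re t\<bar> \<le> \<bar>sin (pi * Re t)\<bar>"
      using t by (intro abs_sin_ge_two_over_pi) (simp add: abs_mult)
    then show "(2 / pi * \<bar>pi * Re t\<bar>)\<^sup>2 \<le> (sin (pi * Re t))\<^sup>2"
      by (subst power2_abs[symmetric, of "sin _"], intro power_mono) auto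
  qed (use abs_le_abs_exp_minus_exp[of "pi * Im t"] in \<open>auto simp: abs_le_square_iff\<close>)
  also have "(2 / pi * \<bar>pi * Re t\<bar>)\<^sup>2 = 4 * (Re t)\<^sup>2" by (simp add: abs_mult power_mult_distrib)
  finally have "4 * (Re t)\<^sup>2 + (pi * Im t)\<^sup>2 / 4 \<le> (norm (sin (of_real pi * w)))\<^sup>2" by simp
  moreover have "4 * (Im t)\<^sup>2 \<le> pi\<^sup>2 * (Im t)\<^sup>2"
    using power_mono[of 2 pi 2] pi_ge_two by (intro mult_right_mono) auto
  then have "(norm t)\<^sup>2 \<le> 4 * (Re t)\<^sup>2 + (pi * Im t)\<^sup>2 / 4"
    using zero_le_power2[of "Re t"] unfolding cmod_power2 power_mult_distrib by linarith
  ultimately have "(norm t)\<^sup>2 \<le> (norm (sin (of_real pi * w)))\<^sup>2" by linarith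
  then have "norm t \<le> norm (sin (of_real pi * w))" by (rule power2_le_imp_le) simp
  then show ?thesis by (simp only: t_def N_def)
qed

lemma norm_sin_le_exp: "norm (sin z) \<le> exp \<bar>Im z\<bar>"
proof -
  have "norm (sin z) = norm (exp (\<i> * z) - exp (- (\<i> * z))) / 2"
    by (simp add: sin_exp_eq norm_divide norm_mult)
  also have "\<dots> \<le> (exp (- Im z) + exp (Im z)) / 2"
    by (intro divide_right_mono order_trans[OF norm_triangle_ineq4]) auto
  also have "\<dots> \<le> exp \<bar>Im z\<bar>"
    by (cases "Im z \<ge> 0") auto
  finally show ?thesis .
qed

text \<open>Euler's reflection formula solved for one factor, which requires
  \<open>Gamma w * rGamma w = 1\<close>. At positive integers \<open>w\<close> the first identity
  reads 0 = 0, since Gamma at a pole and division by zero both have the value 0.\<close>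

lemma Gamma_one_minus:
  fixes w :: complex
  assumes "w \<notin> \<int>\<^sub>\<le>\<^sub>0"
  shows "Gamma (1 - w) = rGamma w * (of_real pi / sin (of_real pi * w))"
    and "rGamma (1 - w) = Gamma w * (sin (of_real pi * w) / of_real pi)"
proof -
  have "Gamma w \<noteq> 0" using assms by (simp add: Gamma_eq_zero_iff)
  then have "Gamma (1 - w) = rGamma w * (Gamma w * Gamma (1 - w))"
    and "rGamma (1 - w) = Gamma w * (rGamma w * rGamma (1 - w))"
    by (simp_all add: rGamma_inverse_Gamma)
  then show "Gamma (1 - w) = rGamma w * (of_real pi / sin (of_real pi * w))"
    and "rGamma (1 - w) = Gamma w * (sin (of_real pi * w) / of_real pi)"
    by (simp_all only: Gamma_reflection_complex rGamma_reflection_complex)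
qed

section \<open>Decay of the integrand and of the residues\<close>

text \<open>The hypotheses that do not mention the loop: the decay estimates, the residues and the
  convergence of the series rest on these alone.\<close>

locale foxH_convergent =
  fixes m n p q :: nat
    and a b :: "nat \<Rightarrow> complex" and \<alpha> \<beta> :: "nat \<Rightarrow> real" and L :: complex
  assumes mq: "m \<le> q" and np: "n \<le> p"
    and \<alpha>_pos: "i \<in> {1..p} \<Longrightarrow> \<alpha> i > 0"
    and \<beta>_pos: "j \<in> {1..q} \<Longrightarrow> \<beta> j > 0"
    and poles_ab: "i \<in> {1..n} \<Longrightarrow> j \<in> {1..m} \<Longrightarrow>
           of_real (\<beta> j) * (a i - 1 - of_nat k) \<noteq> of_real (\<alpha> i) * (b j + of_nat l)"
    and poles_aa: "i \<in> {1..n} \<Longrightarrow> j \<in> {1..n} \<Longrightarrow> i \<noteq> j \<Longrightarrow>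
           of_real (\<alpha> j) * (1 - a i + of_nat k) \<noteq> of_real (\<alpha> i) * (1 - a j + of_nat l)"
    and conv: "foxH_Delta p q \<alpha> \<beta> < 0 \<or>
         foxH_Delta p q \<alpha> \<beta> = 0 \<and> norm (exp L) > foxH_delta p q \<alpha> \<beta>"
begin

abbreviation "pole \<equiv> foxH_pole a \<alpha>"
abbreviation "integrand \<equiv> foxH_integrand m n p q a \<alpha> b \<beta> L"
abbreviation "residue_term \<equiv> foxH_term m n p q a \<alpha> b \<beta> L"

text \<open>The integrand far to the right is this factor times the \<open>n\<close> cosecants
  \<open>csc_factor\<close>; this factor decays there, and all poles come from the
  cosecants.\<close>

definition "regular_part s = foxH_gammas p q a \<alpha> b \<beta> L s *
  (\<Prod>j=m+1..q. sin (of_real pi * (b j + of_real (\<beta> j) * s)) / of_real pi)"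

definition "csc_factor i s = of_real pi / sin (of_real pi * (a i + of_real (\<alpha> i) * s))"

lemma \<alpha>_pos': "i \<in> {1..n} \<Longrightarrow> \<alpha> i > 0"
  using \<alpha>_pos[of i] np by simp

lemma prod_split_q: "(\<Prod>j=1..q. f j) = (\<Prod>j=1..m. f j) * (\<Prod>j=m+1..q. f j :: complex)"
  using prod.ub_add_nat[of 1 m f "q - m"] mq by simp

lemma prod_split_p: "(\<Prod>j=1..p. f j) = (\<Prod>j=1..n. f j) * (\<Prod>j=n+1..p. f j :: complex)"
  using prod.ub_add_nat[of 1 n f "p - n"] np by simp

lemma pole_eq: "i \<in> {1..n} \<Longrightarrow> a i + of_real (\<alpha> i) * pole i k = of_nat (Suc k)"
  using \<alpha>_pos'[of i] by (simp add: foxH_pole_def)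

lemma integrand_eq:
  assumes "\<And>j. j \<in> {m+1..q} \<Longrightarrow> b j + of_real (\<beta> j) * s \<notin> \<int>\<^sub>\<le>\<^sub>0"
    and "\<And>i. i \<in> {1..n} \<Longrightarrow> a i + of_real (\<alpha> i) * s \<notin> \<int>\<^sub>\<le>\<^sub>0"
  shows "integrand s = regular_part s * (\<Prod>i=1..n. csc_factor i s)"
proof -
  have "(\<Prod>i=1..n. Gamma (1 - a i - of_real (\<alpha> i) * s)) =
      (\<Prod>i=1..n. rGamma (a i + of_real (\<alpha> i) * s) * csc_factor i s)"
    using Gamma_one_minus(1)[OF assms(2)] by (intro prod.cong) (auto simp: csc_factor_def diff_diff_eq)
  moreover have "(\<Prod>j=m+1..q. rGamma (1 - b j - of_real (\<beta> j) * s)) =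
      (\<Prod>j=m+1..q. Gamma (b j + of_real (\<beta> j) * s) * (sin (of_real pi * (b j + of_real (\<beta> j) * s)) / of_real pi))"
    using Gamma_one_minus(2)[OF assms(1)] by (intro prod.cong) (auto simp: diff_diff_eq)
  ultimately show ?thesis
    unfolding foxH_integrand_def foxH_kernel_def regular_part_def foxH_gammas_def prod_split_p prod_split_q
    by (simp only: prod.distrib mult_ac)
qed

text \<open>The same reflections as for the integrand, with the \<open>i\<close>-th factor set
  apart: its reciprocal Gamma takes the value \<open>1 / Gamma (k + 1) = 1 / k!\<close> at the pole,
  which is the factorial in the coefficient, and only \<open>(-1)^k / \<alpha> i\<close> remains in
  place of its cosecant.\<close>

lemma residue_term_eq:
  assumes i: "i \<in> {1..n}"
    and "\<And>j. j \<in> {m+1..q} \<Longrightarrow> b j + of_real (\<beta> j) * pole i k \<notin> \<int>\<^sub>\<le>\<^sub>0"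
    and "\<And>j. j \<in> {1..n} \<Longrightarrow> a j + of_real (\<alpha> j) * pole i k \<notin> \<int>\<^sub>\<le>\<^sub>0"
  shows "residue_term i k = regular_part (pole i k) * (\<Prod>j\<in>{1..n}-{i}. csc_factor j (pole i k)) * ((-1)^k / of_real (\<alpha> i))"
proof -
  define s where "s = pole i k"
  have sub: "(1 - a i + of_nat k) * of_real (\<gamma> / \<alpha> i) = of_real \<gamma> * s" for \<gamma>
    using \<alpha>_pos'[OF i] by (simp add: s_def foxH_pole_def)
  have ex: "(a i - of_nat k - 1) / of_real (\<alpha> i) * L = - s * L"
    using \<alpha>_pos'[OF i] by (simp add: s_def foxH_pole_def field_simps)
  have "(\<Prod>j\<in>{1..n}-{i}. Gamma (1 - a j - of_real (\<alpha> j) * s)) =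
      (\<Prod>j\<in>{1..n}-{i}. rGamma (a j + of_real (\<alpha> j) * s) * csc_factor j s)"
    using Gamma_one_minus(1)[OF assms(3)] by (intro prod.cong) (auto simp: csc_factor_def diff_diff_eq s_def)
  moreover have "(\<Prod>j=m+1..q. rGamma (1 - b j - of_real (\<beta> j) * s)) =
      (\<Prod>j=m+1..q. Gamma (b j + of_real (\<beta> j) * s) * (sin (of_real pi * (b j + of_real (\<beta> j) * s)) / of_real pi))"
    using Gamma_one_minus(2)[OF assms(2)] by (intro prod.cong) (auto simp: diff_diff_eq s_def)
  moreover have "(\<Prod>j=1..n. rGamma (a j + of_real (\<alpha> j) * s)) =
      inverse (fact k) * (\<Prod>j\<in>{1..n}-{i}. rGamma (a j + of_real (\<alpha> j) * s))"
    using i pole_eq[OF i, of k] by (subst prod.remove[of _ i]) (auto simp: s_def rGamma_inverse_Gamma Gamma_fact[symmetric] add.commute)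
  ultimately show ?thesis
    unfolding foxH_term_def foxH_coeff_def regular_part_def foxH_gammas_def prod_split_p prod_split_q sub ex s_def[symmetric]
    by (simp add: prod.distrib mult_ac divide_inverse)
qed

text \<open>The bound \<open>1 / 2\<close> ensures that the integer nearest to
  \<open>Re (a i + \<alpha> i * s)\<close> is at least 1, hence belongs to a pole.\<close>

lemma eventually_regular:
  "\<forall>\<^sub>F x in at_top. \<forall>s. Re s = x \<longrightarrow>
     (\<forall>j\<in>{1..q}. Re (b j + of_real (\<beta> j) * s) > 0) \<and> (\<forall>i\<in>{1..n}. Re (a i + of_real (\<alpha> i) * s) > 1 / 2)"
proof -
  have "\<forall>\<^sub>F x in at_top. \<forall>j\<in>{1..q}. Re (b j) + \<beta> j * x > 0"
  proof (intro eventually_ball_finite ballI)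
    fix j assume "j \<in> {1..q}"
    from \<beta>_pos[OF this] show "\<forall>\<^sub>F x in at_top. Re (b j) + \<beta> j * x > 0" by real_asymp
  qed auto
  moreover have "\<forall>\<^sub>F x in at_top. \<forall>i\<in>{1..n}. Re (a i) + \<alpha> i * x > 1 / 2"
  proof (intro eventually_ball_finite ballI)
    fix i assume "i \<in> {1..n}"
    from \<alpha>_pos'[OF this] show "\<forall>\<^sub>F x in at_top. Re (a i) + \<alpha> i * x > 1 / 2" by real_asymp
  qed auto
  ultimately show ?thesis by eventually_elim auto
qed

lemma norm_regular_part_le:
  obtains c K x0 where "c > 0" "K > 0"
    "\<And>s. Re s \<ge> x0 \<Longrightarrow> \<bar>Im s\<bar> \<le> M \<Longrightarrow> norm (regular_part s) \<le> K * exp (- c * Re s)"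
proof -
  obtain c x0 where c: "c > 0" and *:
    "\<And>s. Re s \<ge> x0 \<Longrightarrow> \<bar>Im s\<bar> \<le> M \<Longrightarrow> norm (foxH_gammas p q a \<alpha> b \<beta> L s) \<le> exp (- c * Re s)"
    using norm_foxH_gammas_le[OF \<alpha>_pos \<beta>_pos conv] by metis
  define K where "K = (\<Prod>j=m+1..q. exp (pi * (\<bar>Im (b j)\<bar> + \<beta> j * M)) / pi)"
  show ?thesis
  proof (rule that[OF c])
    show "K > 0" unfolding K_def by (intro prod_pos) auto
    fix s assume s: "Re s \<ge> x0" "\<bar>Im s\<bar> \<le> M"
    have "norm (\<Prod>j=m+1..q. sin (of_real pi * (b j + of_real (\<beta> j) * s)) / of_real pi) \<le> K"
      unfolding K_def prod_norm[symmetric]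
    proof (intro prod_mono conjI)
      fix j assume "j \<in> {m+1..q}"
      then have "\<beta> j > 0" using \<beta>_pos by simp
      have "norm (sin (of_real pi * (b j + of_real (\<beta> j) * s))) \<le> exp \<bar>pi * (Im (b j) + \<beta> j * Im s)\<bar>"
        using norm_sin_le_exp[of "of_real pi * (b j + of_real (\<beta> j) * s)"] by simp
      also have "\<dots> \<le> exp (pi * (\<bar>Im (b j)\<bar> + \<beta> j * M))"
        using s \<open>\<beta> j > 0\<close> by (auto simp: abs_mult intro!: abs_triangle_ineq[THEN order_trans])
      finally show "norm (sin (of_real pi * (b j + of_real (\<beta> j) * s)) / of_real pi) \<le> exp (pi * (\<bar>Im (b j)\<bar> + \<beta> j * M)) / pi"
        by (simp add: norm_divide divide_right_mono)
    qed auto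
    then show "norm (regular_part s) \<le> K * exp (- c * Re s)"
      unfolding regular_part_def norm_mult using *[OF s] by (subst mult.commute, intro mult_mono) auto
  qed
qed

text \<open>The integer nearest to the real part of \<open>w = a i + \<alpha> i * s\<close> is some
  \<open>k + 1\<close>, the image of the \<open>k\<close>-th pole, so the distance of
  \<open>w\<close> from it is \<open>\<alpha> i\<close> times the distance of \<open>s\<close> from
  that pole.\<close>

lemma norm_csc_factor_le:
  assumes i: "i \<in> {1..n}" and s: "Re (a i + of_real (\<alpha> i) * s) > 1 / 2"
    and d: "d > 0" "\<And>k. d \<le> dist s (pole i k)"
  shows "norm (csc_factor i s) \<le> pi / (\<alpha> i * d)"
proof -
  define w where "w = a i + of_real (\<alpha> i) * s"
  define k where "k = nat (round (Re w) - 1)"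
  have "round (Re w) \<ge> 1" using s by (simp add: w_def round_def le_floor_iff)
  then have "round (Re w) = int (Suc k)" by (simp add: k_def)
  then have "complex_of_int (round (Re w)) = of_nat (Suc k)" by simp
  also have "\<dots> = a i + of_real (\<alpha> i) * pole i k" using pole_eq[OF i] by simp
  finally have "w - of_int (round (Re w)) = of_real (\<alpha> i) * (s - pole i k)"
    by (simp add: w_def algebra_simps)
  then have "\<alpha> i * d \<le> norm (w - of_int (round (Re w)))"
    using d(2)[of k] \<alpha>_pos'[OF i] by (simp add: norm_mult dist_norm)
  also have "\<dots> \<le> norm (sin (of_real pi * w))" by (rule norm_sin_pi_ge)
  finally have "\<alpha> i * d \<le> norm (sin (of_real pi * w))" .
  then show ?thesis
    using frac_le[of pi pi "\<alpha> i * d" "norm (sin (of_real pi * w))"] d(1) \<alpha>_pos'[OF i]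
    by (simp add: csc_factor_def w_def norm_divide)
qed

text \<open>The maximum with 1 and \<open>d \<le> 1\<close> make every factor of the bound at least
  1, so the product over \<open>A\<close> may be extended to all indices. This gives one bound for
  the integrand (\<open>A\<close> full) and for a residue (\<open>A\<close> without its own
  index).\<close>

lemma norm_prod_csc_factor_le:
  assumes A: "A \<subseteq> {1..n}" and s: "\<And>i. i \<in> {1..n} \<Longrightarrow> Re (a i + of_real (\<alpha> i) * s) > 1 / 2"
    and d: "0 < d" "d \<le> 1" "\<And>i k. i \<in> A \<Longrightarrow> d \<le> dist s (pole i k)"
  shows "norm (\<Prod>i\<in>A. csc_factor i s) \<le> (\<Prod>i=1..n. max 1 (pi / \<alpha> i)) / d ^ n"
proof -
  have "norm (\<Prod>i\<in>A. csc_factor i s) \<le> (\<Prod>i\<in>A. max 1 (pi / \<alpha> i) / d)"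
    unfolding prod_norm[symmetric]
  proof (intro prod_mono conjI)
    fix i assume i: "i \<in> A"
    have "norm (csc_factor i s) \<le> pi / (\<alpha> i * d)"
      using i A s d by (intro norm_csc_factor_le) auto
    also have "\<dots> = (pi / \<alpha> i) / d" by simp
    also have "\<dots> \<le> max 1 (pi / \<alpha> i) / d" using d by (intro divide_right_mono) auto
    finally show "norm (csc_factor i s) \<le> max 1 (pi / \<alpha> i) / d" .
  qed auto
  also have "\<dots> \<le> (\<Prod>i=1..n. max 1 (pi / \<alpha> i) / d)"
    using A d by (intro prod_mono2) (auto simp: divide_simps)
  also have "\<dots> = (\<Prod>i=1..n. max 1 (pi / \<alpha> i)) / d ^ n"
    by (simp add: prod_dividef)
  finally show ?thesis .
qed

text \<open>The dependence on \<open>d\<close> is explicit because \<open>d\<close> is fixed on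
  half-lines and vertical segments but shrinks exponentially with \<open>k\<close> for the
  residues.\<close>

lemma integrand_bounds:
  obtains c K x0 where "c > 0" "K > 0"
    "\<And>s d. Re s \<ge> x0 \<Longrightarrow> \<bar>Im s\<bar> \<le> M \<Longrightarrow> 0 < d \<Longrightarrow> d \<le> 1 \<Longrightarrow>
       (\<And>i k. i \<in> {1..n} \<Longrightarrow> d \<le> dist s (pole i k)) \<Longrightarrow> norm (integrand s) \<le> K / d ^ n * exp (- c * Re s)"
    "\<And>i k d. i \<in> {1..n} \<Longrightarrow> Re (pole i k) \<ge> x0 \<Longrightarrow> \<bar>Im (pole i k)\<bar> \<le> M \<Longrightarrow> 0 < d \<Longrightarrow> d \<le> 1 \<Longrightarrow>
       (\<And>j l. j \<in> {1..n} - {i} \<Longrightarrow> d \<le> dist (pole i k) (pole j l)) \<Longrightarrow>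
       norm (residue_term i k) \<le> K / \<alpha> i / d ^ n * exp (- c * Re (pole i k))"
proof -
  obtain c K x0 where c: "c > 0" "K > 0" and *:
    "\<And>s. Re s \<ge> x0 \<Longrightarrow> \<bar>Im s\<bar> \<le> M \<Longrightarrow> norm (regular_part s) \<le> K * exp (- c * Re s)"
    using norm_regular_part_le by metis
  obtain x1 where reg: "\<And>s j. Re s \<ge> x1 \<Longrightarrow> j \<in> {1..q} \<Longrightarrow> Re (b j + of_real (\<beta> j) * s) > 0"
     "\<And>s i. Re s \<ge> x1 \<Longrightarrow> i \<in> {1..n} \<Longrightarrow> Re (a i + of_real (\<alpha> i) * s) > 1 / 2"
    using eventually_regular unfolding eventually_at_top_linorder by blast
  define P where "P = (\<Prod>i=1..n. max 1 (pi / \<alpha> i))"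
  have "P > 0" unfolding P_def by (intro prod_pos) auto
  note prod_le = norm_prod_csc_factor_le[folded P_def]
  have pos: "w \<notin> \<int>\<^sub>\<le>\<^sub>0" if "Re w > 0" for w using that by (auto elim!: nonpos_Ints_cases)
  have reg': "b j + of_real (\<beta> j) * s \<notin> \<int>\<^sub>\<le>\<^sub>0" if "Re s \<ge> x1" "j \<in> {m+1..q}" for s j
    using reg(1)[OF that(1), of j] that(2) by (intro pos) auto
  have reg'': "a i + of_real (\<alpha> i) * s \<notin> \<int>\<^sub>\<le>\<^sub>0" if "Re s \<ge> x1" "i \<in> {1..n}" for s i
    using reg(2)[OF that] by (intro pos) linarith
  show ?thesis
  proof
    show "c > 0" "K * P > 0" using c \<open>P > 0\<close> by auto
  next
    fix s :: complex and d assume s: "Re s \<ge> max x0 x1" "\<bar>Im s\<bar> \<le> M"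
      and d: "0 < d" "d \<le> 1" "\<And>i k. i \<in> {1..n} \<Longrightarrow> d \<le> dist s (pole i k)"
    have "integrand s = regular_part s * (\<Prod>i=1..n. csc_factor i s)"
      using s by (intro integrand_eq reg' reg'') auto
    also have "norm \<dots> \<le> (K * exp (- c * Re s)) * (P / d ^ n)"
      unfolding norm_mult using s d *[of s] reg(2)[of s] c \<open>P > 0\<close>
      by (intro mult_mono prod_le) auto
    finally show "norm (integrand s) \<le> K * P / d ^ n * exp (- c * Re s)" by (simp add: mult_ac)
  next
    fix i k and d :: real
    define s where "s = pole i k"
    assume i: "i \<in> {1..n}" and "Re (pole i k) \<ge> max x0 x1" "\<bar>Im (pole i k)\<bar> \<le> M"
      and d: "0 < d" "d \<le> 1" and "\<And>j l. j \<in> {1..n} - {i} \<Longrightarrow> d \<le> dist (pole i k) (pole j l)"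
    then have s: "Re s \<ge> max x0 x1" "\<bar>Im s\<bar> \<le> M" and d': "\<And>j l. j \<in> {1..n} - {i} \<Longrightarrow> d \<le> dist s (pole j l)"
      by (simp_all add: s_def)
    have "residue_term i k = regular_part s * (\<Prod>j\<in>{1..n}-{i}. csc_factor j s) * ((-1)^k / of_real (\<alpha> i))"
      using s i unfolding s_def by (intro residue_term_eq reg' reg'') auto
    also have "norm \<dots> \<le> (K * exp (- c * Re s)) * (P / d ^ n) * (1 / \<alpha> i)"
      unfolding norm_mult using s d d' *[of s] reg(2)[of s] c \<alpha>_pos'[OF i] \<open>P > 0\<close>
      by (intro mult_mono prod_le) (auto simp: norm_divide norm_power)
    finally show "norm (residue_term i k) \<le> K * P / \<alpha> i / d ^ n * exp (- c * Re (pole i k))"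
      by (simp add: mult_ac s_def)
  qed
qed

end

section \<open>Winding numbers of truncated loops\<close>

lemma mem_horizontal_segment:
  "z \<in> closed_segment (Complex x \<phi>) (Complex y \<phi>) \<longleftrightarrow> Im z = \<phi> \<and> Re z \<in> closed_segment x y"
  by (simp add: closed_segment_same_Im)

lemma mem_vertical_segment:
  "z \<in> closed_segment (Complex x \<phi>) (Complex x \<psi>) \<longleftrightarrow> Re z = x \<and> Im z \<in> closed_segment \<phi> \<psi>"
  by (simp add: closed_segment_same_Re)

lemma winding_number_linepath_swap:
  assumes "z \<notin> closed_segment a b"
  shows "winding_number (linepath b a) z = - winding_number (linepath a b) z"
  using winding_number_reversepath[of "linepath a b" z] assms by simp

locale loop =
  fixes \<phi>1 \<phi>2 X :: real and g :: "real \<Rightarrow> complex"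
  assumes is_loop: "is_loop \<phi>1 \<phi>2 X g"
begin

abbreviation "trunc \<equiv> loop_trunc \<phi>1 \<phi>2 X g"
abbreviation "closed_loop \<equiv> loop_closed \<phi>1 \<phi>2 X g"

lemma \<phi>_less: "\<phi>1 < \<phi>2" and valid_g: "valid_path g"
  and start_g: "pathstart g = Complex X \<phi>1" and finish_g: "pathfinish g = Complex X \<phi>2"
  and arc_trunc: "R > X \<Longrightarrow> arc (trunc R)"
  using is_loop by (auto simp: is_loop_def)

lemma path_g: "path g"
  using valid_g by (rule valid_path_imp_path)

lemma start_finish [simp]:
  "pathstart (trunc R) = Complex R \<phi>1" "pathfinish (trunc R) = Complex R \<phi>2"
  "pathstart (closed_loop R) = Complex R \<phi>1" "pathfinish (closed_loop R) = Complex R \<phi>1"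
  by (simp_all add: loop_trunc_def loop_closed_def)

lemma valid_trunc: "valid_path (trunc R)"
  unfolding loop_trunc_def using valid_g start_g finish_g by (intro valid_path_join) auto

lemma valid_closed_loop: "valid_path (closed_loop R)"
  unfolding loop_closed_def using valid_trunc by (intro valid_path_join) auto

lemma path_image_trunc:
  assumes "X \<le> R"
  shows "path_image (trunc R) = path_image g \<union> {z. Im z \<in> {\<phi>1, \<phi>2} \<and> X \<le> Re z \<and> Re z \<le> R}"
proof -
  have "closed_segment R X = {X..R}" "closed_segment X R = {X..R}"
    using assms by (auto simp: closed_segment_eq_real_ivl)
  then have "path_image (trunc R) = {z. Im z = \<phi>1 \<and> Re z \<in> {X..R}} \<union> (path_image g \<union> {z. Im z = \<phi>2 \<and> Re z \<in> {X..R}})"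
    using start_g finish_g
    by (auto simp: loop_trunc_def path_image_join mem_horizontal_segment)
  then show ?thesis by auto
qed

lemma path_image_closed_loop:
  assumes "X \<le> R"
  shows "path_image (closed_loop R) = path_image (trunc R) \<union> {z. Re z = R \<and> \<phi>1 \<le> Im z \<and> Im z \<le> \<phi>2}"
  using assms \<phi>_less
  by (auto simp: loop_closed_def path_image_join mem_vertical_segment closed_segment_eq_real_ivl
       )

text \<open>To the right of this abscissa the loop consists of the two half-lines only.\<close>

definition "xmax = Sup (Re ` path_image g)"

lemma Re_le_xmax: "z \<in> path_image g \<Longrightarrow> Re z \<le> xmax"
proof -
  assume "z \<in> path_image g"
  moreover have "compact (Re ` path_image g)"
    using path_g by (intro compact_continuous_image compact_path_image continuous_intros)
  ultimately show ?thesis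
    unfolding xmax_def by (intro cSup_upper bounded_imp_bdd_above compact_imp_bounded) auto
qed

lemma X_le_xmax: "X \<le> xmax"
  using Re_le_xmax[OF pathstart_in_path_image] start_g by simp

lemma Re_le_closed_loop:
  assumes "xmax \<le> R" "z \<in> path_image (closed_loop R)"
  shows "Re z \<le> R"
  using assms X_le_xmax Re_le_xmax[of z] by (force simp: path_image_closed_loop path_image_trunc)

lemma winding_number_closed_loop:
  assumes "X \<le> R" "z \<notin> path_image (closed_loop R)"
  shows "winding_number (closed_loop R) z =
           - winding_number (linepath (Complex X \<phi>1) (Complex R \<phi>1)) z + winding_number g z
           + winding_number (linepath (Complex X \<phi>2) (Complex R \<phi>2)) z
           - winding_number (linepath (Complex R \<phi>1) (Complex R \<phi>2)) z"
proof -
  have nz: "z \<notin> closed_segment (Complex X \<phi>1) (Complex R \<phi>1)" "z \<notin> path_image g"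
    "z \<notin> closed_segment (Complex X \<phi>2) (Complex R \<phi>2)" "z \<notin> closed_segment (Complex R \<phi>1) (Complex R \<phi>2)"
    using assms start_g finish_g
    by (auto simp: loop_closed_def loop_trunc_def path_image_join closed_segment_commute)
  show ?thesis
    unfolding loop_closed_def loop_trunc_def using nz path_g start_g finish_g
      winding_number_linepath_swap[OF nz(1)] winding_number_linepath_swap[OF nz(4)]
    by (simp add: winding_number_join path_image_join closed_segment_commute)
qed

text \<open>Moving the closing segment from \<open>R\<close> to \<open>R'\<close> adds the boundary
  of the rectangle in between, traversed clockwise; the parts on the half-lines up to
  \<open>R\<close> cancel.\<close>

lemma winding_number_closed_loop_extend:
  assumes "X \<le> R" "R \<le> R'" "z \<notin> path_image (closed_loop R)" "z \<notin> path_image (closed_loop R')"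
  shows "winding_number (closed_loop R') z =
           winding_number (closed_loop R) z - winding_number (rectpath (Complex R \<phi>1) (Complex R' \<phi>2)) z"
proof -
  have nz: "z \<notin> closed_segment (Complex X \<phi>1) (Complex R' \<phi>1)" "z \<notin> closed_segment (Complex X \<phi>2) (Complex R' \<phi>2)"
    "z \<notin> closed_segment (Complex R \<phi>1) (Complex R' \<phi>1)" "z \<notin> closed_segment (Complex R \<phi>2) (Complex R' \<phi>2)"
    "z \<notin> closed_segment (Complex R \<phi>1) (Complex R \<phi>2)" "z \<notin> closed_segment (Complex R' \<phi>1) (Complex R' \<phi>2)"
    using assms \<phi>_less
    by (auto simp: path_image_closed_loop path_image_trunc mem_horizontal_segment mem_vertical_segment
          closed_segment_eq_real_ivl)
  have split: "winding_number (linepath (Complex X \<phi>) (Complex R' \<phi>)) z =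
      winding_number (linepath (Complex X \<phi>) (Complex R \<phi>)) z + winding_number (linepath (Complex R \<phi>) (Complex R' \<phi>)) z"
    if "z \<notin> closed_segment (Complex X \<phi>) (Complex R' \<phi>)" for \<phi>
    using assms that
    by (intro winding_number_split_linepath) (auto simp: mem_horizontal_segment closed_segment_eq_real_ivl)
  have "winding_number (rectpath (Complex R \<phi>1) (Complex R' \<phi>2)) z =
      winding_number (linepath (Complex R \<phi>1) (Complex R' \<phi>1)) z + winding_number (linepath (Complex R' \<phi>1) (Complex R' \<phi>2)) z
      - winding_number (linepath (Complex R \<phi>2) (Complex R' \<phi>2)) z - winding_number (linepath (Complex R \<phi>1) (Complex R \<phi>2)) z"
    unfolding rectpath_def Let_def using nz
      winding_number_linepath_swap[OF nz(4)] winding_number_linepath_swap[OF nz(5)]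
    by (simp add: winding_number_join path_image_join closed_segment_commute)
  then show ?thesis
    using assms nz by (simp add: winding_number_closed_loop split)
qed

lemma winding_number_closed_loop_right:
  assumes "xmax \<le> R" "R < Re z"
  shows "winding_number (closed_loop R) z = 0"
proof (rule winding_number_zero_outside[where s = "{z. Re z \<le> R}"])
  show "path_image (closed_loop R) \<subseteq> {z. Re z \<le> R}"
    using Re_le_closed_loop assms by blast
qed (use assms valid_closed_loop in \<open>auto simp: valid_path_imp_path convex_halfspace_Re_le\<close>)

text \<open>Beyond \<open>xmax\<close> the closing segment meets the truncated loop only in its two
  endpoints. Simplicity makes the winding number constant on the inside.\<close>

lemma simple_path_closed_loop:
  assumes "xmax < R"
  shows "simple_path (closed_loop R)"
  unfolding loop_closed_def
proof (rule simple_path_join_loop)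
  have XR: "X < R" using assms X_le_xmax by simp
  then show "arc (trunc R)" by (rule arc_trunc)
  show "arc (linepath (Complex R \<phi>2) (Complex R \<phi>1))" using \<phi>_less by (intro arc_linepath) simp
  show "path_image (trunc R) \<inter> path_image (linepath (Complex R \<phi>2) (Complex R \<phi>1)) \<subseteq>
      {pathstart (trunc R), pathstart (linepath (Complex R \<phi>2) (Complex R \<phi>1))}"
    using XR assms Re_le_xmax
    by (force simp: path_image_trunc mem_vertical_segment complex_eq_iff)
qed auto

lemma winding_number_nonzero_imp_inside:
  assumes "z \<notin> path_image (closed_loop R)" "winding_number (closed_loop R) z \<noteq> 0"
  shows "z \<in> inside (path_image (closed_loop R))"
proof -
  have "z \<notin> outside (path_image (closed_loop R))"
    using assms winding_number_zero_in_outside[of "closed_loop R" z] valid_closed_loop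
    by (auto simp: valid_path_imp_path)
  then show ?thesis using assms inside_Un_outside by blast
qed

text \<open>The orientation is read off at a point between two truncations: the shorter truncation does
  not wind around it, and the two differ by the boundary of a rectangle.\<close>

lemma winding_number_closed_loop_inside:
  assumes R: "xmax < R" and z: "z \<in> inside (path_image (closed_loop R))"
  shows "winding_number (closed_loop R) z = -1"
proof -
  define R0 where "R0 = (xmax + R) / 2"
  define c where "c = Complex ((R0 + R) / 2) ((\<phi>1 + \<phi>2) / 2)"
  have R0: "xmax < R0" "R0 < R" "X \<le> R0" using R X_le_xmax by (auto simp: R0_def)
  have Re_c: "R0 < Re c" "Re c < R" and Im_c: "\<phi>1 < Im c" "Im c < \<phi>2"
    using R0 \<phi>_less by (auto simp: c_def)
  have c: "c \<notin> path_image (closed_loop R0)" "c \<notin> path_image (closed_loop R)"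
    using R0 Re_c Im_c Re_le_xmax[of c] by (auto simp: path_image_closed_loop path_image_trunc)
  have "c \<in> box (Complex R0 \<phi>1) (Complex R \<phi>2)"
    using Re_c Im_c by (simp add: in_box_complex_iff)
  then have wn: "winding_number (closed_loop R) c = -1"
    using winding_number_closed_loop_extend[of R0 R c] R0 c Re_c
    by (simp add: winding_number_rectpath winding_number_closed_loop_right)
  then have "c \<in> inside (path_image (closed_loop R))"
    using c by (intro winding_number_nonzero_imp_inside) auto
  from simple_closed_path_winding_number_inside[OF simple_path_closed_loop[OF R]] this z wn
  show ?thesis by (metis one_neq_neg_one)
qed

text \<open>Carries the information about all sufficiently long truncations back to any one that
  reaches beyond \<open>z\<close>: the rectangle between the two lies to the right of
  \<open>z\<close> and does not wind around it.\<close>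

lemma winding_number_eventually_eq:
  assumes R: "xmax < R" "Re z < R"
    and ev: "\<forall>\<^sub>F R' in at_top. z \<notin> path_image (closed_loop R') \<and> winding_number (closed_loop R') z = w"
  shows "z \<notin> path_image (closed_loop R)" "winding_number (closed_loop R) z = w"
proof -
  have "\<forall>\<^sub>F R' in at_top. z \<notin> path_image (closed_loop R') \<and> winding_number (closed_loop R') z = w \<and> R \<le> R'"
    using ev eventually_ge_at_top[of R] by eventually_elim auto
  then obtain R' where R': "z \<notin> path_image (closed_loop R')" "winding_number (closed_loop R') z = w" "R \<le> R'"
    using eventually_happens[of _ "at_top :: real filter"] by force
  have XR: "X \<le> R" using R X_le_xmax by simp
  show z: "z \<notin> path_image (closed_loop R)"
    using R R' XR by (auto simp: path_image_closed_loop path_image_trunc)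
  have "winding_number (rectpath (Complex R \<phi>1) (Complex R' \<phi>2)) z = 0"
    using R R' \<phi>_less by (intro winding_number_rectpath_outside) (auto simp: in_cbox_complex_iff)
  then show "winding_number (closed_loop R) z = w"
    using winding_number_closed_loop_extend[OF XR R'(3) z R'(1)] R'(2) by simp
qed

lemma winding_number_inside_loop:
  assumes "z \<in> inside_loop \<phi>1 \<phi>2 X g" "xmax < R" "Re z < R"
  shows "z \<notin> path_image (closed_loop R)" "winding_number (closed_loop R) z = -1"
proof -
  have "\<forall>\<^sub>F R' in at_top. z \<in> inside (path_image (closed_loop R'))"
    using assms by (simp add: inside_loop_def)
  with eventually_gt_at_top[of xmax]
  have "\<forall>\<^sub>F R' in at_top. z \<notin> path_image (closed_loop R') \<and> winding_number (closed_loop R') z = -1"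
    by eventually_elim (auto simp: winding_number_closed_loop_inside dest: inside_no_overlap[THEN equalityD1, THEN subsetD, OF IntI])
  from winding_number_eventually_eq[OF assms(2,3) this]
  show "z \<notin> path_image (closed_loop R)" "winding_number (closed_loop R) z = -1" .
qed

lemma winding_number_outside_loop:
  assumes "z \<in> outside_loop \<phi>1 \<phi>2 X g" "xmax < R" "Re z < R"
  shows "z \<notin> path_image (closed_loop R)" "winding_number (closed_loop R) z = 0"
proof -
  have "\<forall>\<^sub>F R' in at_top. z \<in> outside (path_image (closed_loop R'))"
    using assms by (simp add: outside_loop_def)
  then have "\<forall>\<^sub>F R' in at_top. z \<notin> path_image (closed_loop R') \<and> winding_number (closed_loop R') z = 0"
    by eventually_elim (auto intro!: winding_number_zero_in_outside valid_path_imp_path valid_closed_loop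
        dest: outside_no_overlap[THEN equalityD1, THEN subsetD, OF IntI])
  from winding_number_eventually_eq[OF assms(2,3) this]
  show "z \<notin> path_image (closed_loop R)" "winding_number (closed_loop R) z = 0" .
qed

lemma not_on_loop:
  assumes "z \<in> inside_loop \<phi>1 \<phi>2 X g \<or> z \<in> outside_loop \<phi>1 \<phi>2 X g"
  shows "z \<notin> path_image g" "Re z \<ge> X \<Longrightarrow> Im z \<noteq> \<phi>1" "Re z \<ge> X \<Longrightarrow> Im z \<noteq> \<phi>2"
proof -
  define R where "R = max xmax (Re z) + 1"
  have "xmax < R" "Re z < R" by (auto simp: R_def)
  then have "z \<notin> path_image (closed_loop R)"
    using assms winding_number_inside_loop(1) winding_number_outside_loop(1) by blast
  moreover have "X \<le> R" "Re z \<le> R" using X_le_xmax by (auto simp: R_def)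
  ultimately show "z \<notin> path_image g" "Re z \<ge> X \<Longrightarrow> Im z \<noteq> \<phi>1" "Re z \<ge> X \<Longrightarrow> Im z \<noteq> \<phi>2"
    by (auto simp: path_image_closed_loop path_image_trunc)
qed

end

section \<open>Integrals along half-lines and truncated loops\<close>

lemma set_integrable_exp_minus:
  fixes c r :: real
  assumes "c > 0"
  shows "set_integrable lborel {r..} (\<lambda>x. exp (- c * x))"
proof -
  have "(\<lambda>x. exp (- c * x)) absolutely_integrable_on {r..}"
    using integrable_on_exp_minus_to_infinity[OF assms] by (intro nonnegative_absolutely_integrable_1) auto
  then show ?thesis
    unfolding set_integrable_def by (subst (asm) integrable_completion) auto
qed

text \<open>The exponential dominates on the tail; on the compact piece before \<open>x0\<close>,
  continuity is enough.\<close>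

lemma set_integrable_exp_bound:
  fixes f :: "real \<Rightarrow> complex"
  assumes cont: "continuous_on {r..} f" and c: "c > 0"
    and bound: "\<And>x. x \<ge> r \<Longrightarrow> x \<ge> x0 \<Longrightarrow> norm (f x) \<le> K * exp (- c * x)"
  shows "set_integrable lborel {r..} f"
proof -
  define y where "y = max r x0"
  have meas: "set_borel_measurable lborel A f" if "A \<in> sets borel" "A \<subseteq> {r..}" for A
    using borel_measurable_continuous_on_indicator[OF that(1) continuous_on_subset[OF cont that(2)]]
    unfolding set_borel_measurable_def by simp
  have "set_integrable lborel {r..y} f"
    by (rule borel_integrable_atLeastAtMost') (rule continuous_on_subset[OF cont], auto)
  moreover have "set_integrable lborel {y..} f"
  proof (rule set_integrable_bound)
    show "set_integrable lborel {y..} (\<lambda>x. K * exp (- c * x))"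
      using set_integrable_exp_minus[OF c] by (intro set_integrable_mult_right) auto
    show "AE x in lborel. x \<in> {y..} \<longrightarrow> norm (f x) \<le> norm (K * exp (- c * x))"
      using bound by (auto simp: y_def intro!: AE_I2 order_trans[OF _ abs_ge_self])
  qed (auto intro!: meas simp: y_def)
  ultimately have "set_integrable lborel ({r..y} \<union> {y..}) f"
    by (intro set_integrable_Un) auto
  moreover have "{r..y} \<union> {y..} = {r..}" by (auto simp: y_def)
  ultimately show ?thesis by simp
qed

text \<open>Moves a horizontal segment to the real axis, where a contour integral is an ordinary
  one.\<close>

lemma contour_integral_linepath_translate:
  "contour_integral (linepath (x + c) (y + c)) f = contour_integral (linepath x y) (\<lambda>z. f (z + c))"
proof -
  have "linepath (x + c) (y + c) t = linepath x y t + c" for t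
    by (simp add: linepath_def algebra_simps)
  then have "(f has_contour_integral I) (linepath (x + c) (y + c)) \<longleftrightarrow>
      ((\<lambda>z. f (z + c)) has_contour_integral I) (linepath x y)" for I
    unfolding has_contour_integral_linepath by simp
  then show ?thesis by (simp add: contour_integral_def contour_integrable_on_def)
qed

lemma contour_integral_horizontal:
  assumes "x < y" and f: "continuous_on (closed_segment (Complex x \<phi>) (Complex y \<phi>)) f"
  shows "contour_integral (linepath (Complex x \<phi>) (Complex y \<phi>)) f = (LINT t:{x..y}|lborel. f (Complex t \<phi>))"
proof -
  have eq: "Complex t \<phi> = complex_of_real t + \<i> * of_real \<phi>" for t by (simp add: complex_eq_iff)
  have "continuous_on {x..y} (\<lambda>t. Complex t \<phi>)"
    unfolding eq by (intro continuous_intros)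
  then have "continuous_on {x..y} (\<lambda>t. f (Complex t \<phi>))"
    using \<open>x < y\<close>
    by (intro continuous_on_compose2[OF f]) (auto simp: mem_horizontal_segment closed_segment_eq_real_ivl)
  then have "set_integrable lborel {x..y} (\<lambda>t. f (Complex t \<phi>))"
    by (rule borel_integrable_atLeastAtMost')
  then have "(LINT t:{x..y}|lborel. f (Complex t \<phi>)) = integral {x..y} (\<lambda>t. f (Complex t \<phi>))"
    by (rule set_borel_integral_eq_integral)
  also have "\<dots> = contour_integral (linepath (of_real x) (of_real y)) (\<lambda>z. f (z + \<i> * of_real \<phi>))"
    using \<open>x < y\<close> by (subst contour_integral_linepath_Reals_eq) (auto simp: eq)
  also have "\<dots> = contour_integral (linepath (Complex x \<phi>) (Complex y \<phi>)) f"
    unfolding contour_integral_linepath_translate[symmetric] eq[symmetric] ..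
  finally show ?thesis ..
qed

lemma contour_integral_linepath_swap: "contour_integral (linepath b a) f = - contour_integral (linepath a b) f"
  using contour_integral_reversepath[of "linepath a b" f] by simp

context loop begin

text \<open>As \<open>R\<close> grows, the first three terms tend to \<open>loop_integral\<close>,
  and the last one is to be shown negligible.\<close>

lemma contour_integral_closed_loop:
  assumes R: "xmax < R" and f: "f holomorphic_on S" "open S" "path_image (closed_loop R) \<subseteq> S"
  shows "contour_integral (closed_loop R) f =
     - (LINT t:{X..R}|lborel. f (Complex t \<phi>1)) + contour_integral g f + (LINT t:{X..R}|lborel. f (Complex t \<phi>2))
     - contour_integral (linepath (Complex R \<phi>1) (Complex R \<phi>2)) f"
proof -
  have XR: "X < R" using R X_le_xmax by simp
  have sub: "closed_segment (Complex X \<phi>1) (Complex R \<phi>1) \<subseteq> S" "closed_segment (Complex X \<phi>2) (Complex R \<phi>2) \<subseteq> S"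
    "closed_segment (Complex R \<phi>1) (Complex R \<phi>2) \<subseteq> S" "path_image g \<subseteq> S"
    using f(3) start_g finish_g
    by (auto simp: loop_closed_def loop_trunc_def path_image_join closed_segment_commute)
  have int: "f contour_integrable_on \<gamma>" if "valid_path \<gamma>" "path_image \<gamma> \<subseteq> S" for \<gamma>
    using contour_integrable_holomorphic_simple[OF f(1,2) that] .
  have ints: "f contour_integrable_on linepath (Complex X \<phi>1) (Complex R \<phi>1)"
    "f contour_integrable_on linepath (Complex X \<phi>2) (Complex R \<phi>2)"
    "f contour_integrable_on linepath (Complex R \<phi>1) (Complex X \<phi>1)"
    "f contour_integrable_on linepath (Complex R \<phi>2) (Complex R \<phi>1)" "f contour_integrable_on g"
    using sub valid_g by (auto intro!: int simp: closed_segment_commute)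
  have cont: "continuous_on A f" if "A \<subseteq> S" for A
    using that f(1) by (meson continuous_on_subset holomorphic_on_imp_continuous_on)
  have "contour_integral (closed_loop R) f =
      - contour_integral (linepath (Complex X \<phi>1) (Complex R \<phi>1)) f + contour_integral g f
      + contour_integral (linepath (Complex X \<phi>2) (Complex R \<phi>2)) f
      - contour_integral (linepath (Complex R \<phi>1) (Complex R \<phi>2)) f"
    unfolding loop_closed_def loop_trunc_def using ints valid_g start_g finish_g
      contour_integral_linepath_swap[of "Complex R \<phi>1" "Complex X \<phi>1" f]
      contour_integral_linepath_swap[of "Complex R \<phi>2" "Complex R \<phi>1" f]
    by simp
  then show ?thesis
    using XR sub cont by (simp add: contour_integral_horizontal)
qed

end

section \<open>Poles and residues of the integrand\<close>

context foxH_convergent begin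

text \<open>Defined by the condition used in \<open>foxH_loop\<close>, as preimages of a closed set,
  so that closedness is immediate.\<close>

definition "a_poles i = {s. 1 - a i - of_real (\<alpha> i) * s \<in> \<int>\<^sub>\<le>\<^sub>0}"
definition "b_poles j = {s. b j + of_real (\<beta> j) * s \<in> \<int>\<^sub>\<le>\<^sub>0}"
definition "singularities = (\<Union>i\<in>{1..n}. a_poles i) \<union> (\<Union>j\<in>{1..m}. b_poles j)"

lemma a_poles_eq: "i \<in> {1..n} \<Longrightarrow> a_poles i = range (pole i)"
proof -
  assume i: "i \<in> {1..n}"
  have "1 - a i - of_real (\<alpha> i) * s = - of_nat k \<longleftrightarrow> s = pole i k" for s k
    using \<alpha>_pos'[OF i] by (auto simp: foxH_pole_def field_simps)
  moreover have "s \<in> a_poles i \<longleftrightarrow> (\<exists>k. 1 - a i - of_real (\<alpha> i) * s = - of_nat k)" for s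
    by (auto simp: a_poles_def elim!: nonpos_Ints_cases')
  ultimately show ?thesis by auto
qed

lemma closed_a_poles: "closed (a_poles i)"
proof -
  have "a_poles i = (\<lambda>s. 1 - a i - of_real (\<alpha> i) * s) -` \<int>\<^sub>\<le>\<^sub>0" by (auto simp: a_poles_def)
  also have "closed \<dots>" by (intro closed_vimage closed_nonpos_Ints continuous_intros)
  finally show ?thesis .
qed

lemma closed_b_poles: "closed (b_poles j)"
proof -
  have "b_poles j = (\<lambda>s. b j + of_real (\<beta> j) * s) -` \<int>\<^sub>\<le>\<^sub>0" by (auto simp: b_poles_def)
  also have "closed \<dots>" by (intro closed_vimage closed_nonpos_Ints continuous_intros)
  finally show ?thesis .
qed

lemma open_regular: "open (- singularities)"
  unfolding singularities_def
  by (intro open_Compl closed_Un closed_UN ballI closed_a_poles closed_b_poles finite_atLeastAtMost)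

lemma integrand_holomorphic: "integrand holomorphic_on - singularities"
  unfolding foxH_integrand_def[abs_def] foxH_kernel_def
  by (intro holomorphic_intros) (auto simp: singularities_def a_poles_def b_poles_def)

lemma Re_pole: "i \<in> {1..n} \<Longrightarrow> Re (pole i k) = (1 - Re (a i) + real k) / \<alpha> i"
  and Im_pole: "i \<in> {1..n} \<Longrightarrow> Im (pole i k) = - Im (a i) / \<alpha> i"
  by (simp_all add: foxH_pole_def)

lemma Re_pole_less_iff: "i \<in> {1..n} \<Longrightarrow> Re (pole i k) < R \<longleftrightarrow> k < nat \<lceil>\<alpha> i * R + Re (a i) - 1\<rceil>"
proof -
  assume i: "i \<in> {1..n}"
  have "Re (pole i k) < R \<longleftrightarrow> real k < \<alpha> i * R + Re (a i) - 1"
    using \<alpha>_pos'[OF i] by (simp add: Re_pole[OF i] field_simps)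
  also have "\<dots> \<longleftrightarrow> k < nat \<lceil>\<alpha> i * R + Re (a i) - 1\<rceil>" by linarith
  finally show ?thesis .
qed

lemma poles_below_eq: "i \<in> {1..n} \<Longrightarrow> {k. Re (pole i k) < R} = {..<nat \<lceil>\<alpha> i * R + Re (a i) - 1\<rceil>}"
  by (auto simp: Re_pole_less_iff)

lemma pole_eq_iff:
  assumes "i \<in> {1..n}" "j \<in> {1..n}"
  shows "pole i k = pole j l \<longleftrightarrow> i = j \<and> k = l"
proof (cases "i = j")
  case True
  then show ?thesis using \<alpha>_pos'[OF assms(1)] by (auto simp: foxH_pole_def)
next
  case False
  have "pole i k \<noteq> pole j l"
    using poles_aa[OF assms False, of k l] \<alpha>_pos'[OF assms(1)] \<alpha>_pos'[OF assms(2)]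
    by (auto simp: foxH_pole_def field_simps)
  then show ?thesis using False by simp
qed

lemma pole_not_b_pole:
  assumes i: "i \<in> {1..n}" and j: "j \<in> {1..m}"
  shows "pole i k \<notin> b_poles j"
proof
  assume "pole i k \<in> b_poles j"
  then obtain l where "b j + of_real (\<beta> j) * pole i k = - of_nat l"
    by (auto simp: b_poles_def elim!: nonpos_Ints_cases')
  then have "b j + of_nat l = - (of_real (\<beta> j) * pole i k)"
    by (simp add: eq_neg_iff_add_eq_0 add_ac)
  then have "of_real (\<alpha> i) * (b j + of_nat l) = of_real (\<beta> j) * - (of_real (\<alpha> i) * pole i k)"
    by (simp add: mult_ac)
  also have "- (of_real (\<alpha> i) * pole i k) = a i - 1 - of_nat k"
    using \<alpha>_pos'[OF i] by (simp add: foxH_pole_def)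
  finally show False using poles_ab[OF i j, of k l] by simp
qed

text \<open>The poles of each Gamma factor are evenly spaced and run off to the right
  (\<open>a_poles\<close>) or to the left (\<open>b_poles\<close>), so a vertical strip contains
  finitely many.\<close>

lemma finite_singularities: "finite (singularities \<inter> {s. - B < Re s \<and> Re s < R})"
proof -
  have fa: "finite (a_poles i \<inter> {s. Re s < R})" if i: "i \<in> {1..n}" for i
  proof (rule finite_subset)
    show "a_poles i \<inter> {s. Re s < R} \<subseteq> pole i ` {k. Re (pole i k) < R}"
      using a_poles_eq[OF i] by auto
  qed (use poles_below_eq[OF i] in auto)
  have fb: "finite (b_poles j \<inter> {s. - B < Re s})" if j: "j \<in> {1..m}" for j
  proof (rule finite_subset)
    have pos: "\<beta> j > 0" using \<beta>_pos mq j by auto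
    show "b_poles j \<inter> {s. - B < Re s} \<subseteq> (\<lambda>l. (- of_nat l - b j) / of_real (\<beta> j)) ` {..nat \<lceil>\<beta> j * B - Re (b j)\<rceil>}"
    proof
      fix s assume s: "s \<in> b_poles j \<inter> {s. - B < Re s}"
      then obtain l where l: "b j + of_real (\<beta> j) * s = - of_nat l"
        by (auto simp: b_poles_def elim!: nonpos_Ints_cases')
      then have s_eq: "s = (- of_nat l - b j) / of_real (\<beta> j)"
        using pos by (simp add: field_simps eq_diff_eq)
      have "Re (b j + of_real (\<beta> j) * s) = - real l" unfolding l by simp
      moreover have "\<beta> j * - B < \<beta> j * Re s" using s pos by (intro mult_strict_left_mono) auto
      ultimately have "real l \<le> \<beta> j * B - Re (b j)" by simp
      then have "l \<le> nat \<lceil>\<beta> j * B - Re (b j)\<rceil>" by linarith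
      then show "s \<in> (\<lambda>l. (- of_nat l - b j) / of_real (\<beta> j)) ` {..nat \<lceil>\<beta> j * B - Re (b j)\<rceil>}"
        using s_eq by blast
    qed
  qed auto
  have "finite ((\<Union>i\<in>{1..n}. a_poles i \<inter> {s. Re s < R}) \<union> (\<Union>j\<in>{1..m}. b_poles j \<inter> {s. - B < Re s}))"
    by (intro finite_UnI finite_UN_I finite_atLeastAtMost fa fb)
  then show ?thesis by (rule finite_subset[rotated]) (auto simp: singularities_def)
qed

text \<open>With \<open>w = 1 - a i - \<alpha> i * s\<close>, the functional equation gives
  \<open>Gamma w = Gamma (w + k + 1) / pochhammer w (k + 1)\<close>, whose last Pochhammer factor
  \<open>w + k = - \<alpha> i * (s - s0)\<close> exhibits a simple pole and the minus sign.\<close>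

lemma residue_integrand:
  assumes i: "i \<in> {1..n}"
  shows "residue integrand (pole i k) = - residue_term i k"
proof -
  define s0 where "s0 = pole i k"
  define w where "w s = 1 - a i - of_real (\<alpha> i) * s" for s
  define G where "G s = (\<Prod>j=1..m. Gamma (b j + of_real (\<beta> j) * s)) *
     (\<Prod>j\<in>{1..n}-{i}. Gamma (1 - a j - of_real (\<alpha> j) * s)) *
     (\<Prod>i=n+1..p. rGamma (a i + of_real (\<alpha> i) * s)) *
     (\<Prod>j=m+1..q. rGamma (1 - b j - of_real (\<beta> j) * s)) * exp (- s * L)" for s
  define h where "h s = - (Gamma (w s + of_nat (Suc k)) / pochhammer (w s) k) * G s / of_real (\<alpha> i)" for s
  \<comment> \<open>In the unit disc \<open>|w + k| < 1\<close> neither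
    \<open>pochhammer w k\<close> vanishes nor has \<open>Gamma (w + k + 1)\<close> a pole; removing
    the poles of the other factors makes \<open>h\<close> holomorphic on \<open>U\<close>.\<close>
  define U where "U = - ((\<Union>j\<in>{1..n}-{i}. a_poles j) \<union> (\<Union>j\<in>{1..m}. b_poles j)) \<inter> {s. norm (w s + of_nat k) < 1}"
  have \<alpha>i: "\<alpha> i > 0" using \<alpha>_pos'[OF i] .
  have "of_real (\<alpha> i) * s0 = 1 - a i + of_nat k"
    using \<alpha>i by (simp add: s0_def foxH_pole_def)
  then have w: "w s + of_nat k = - of_real (\<alpha> i) * (s - s0)" for s
    by (simp add: w_def right_diff_distrib)
  have sub: "(1 - a i + of_nat k) * of_real (\<gamma> / \<alpha> i) = of_real \<gamma> * s0" for \<gamma>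
    using \<alpha>i by (simp add: s0_def foxH_pole_def)
  have ex: "(a i - of_nat k - 1) / of_real (\<alpha> i) * L = - s0 * L"
    using \<alpha>i by (simp add: s0_def foxH_pole_def field_simps)
  have U: "open U"
    unfolding U_def w_def
    by (intro open_Int open_Compl closed_Un closed_UN ballI finite_Diff finite_atLeastAtMost
         closed_a_poles closed_b_poles open_Collect_less continuous_intros)
  have s0: "s0 \<in> U"
  proof -
    have "s0 \<notin> a_poles j" if "j \<in> {1..n} - {i}" for j
      using that i a_poles_eq[of j] by (auto simp: s0_def pole_eq_iff)
    then show ?thesis using pole_not_b_pole[OF i] w[of s0] by (auto simp: U_def s0_def)
  qed
  have poch: "pochhammer (w s) k \<noteq> 0" if "s \<in> U" for s
  proof
    assume "pochhammer (w s) k = 0"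
    then obtain l where "l < k" "w s = - of_nat l" by (auto simp: pochhammer_eq_0_iff)
    then have "norm (w s + of_nat k) = real (k - l)" by (simp add: of_nat_diff flip: norm_of_nat[where ?'a=complex])
    then show False using that \<open>l < k\<close> by (simp add: U_def)
  qed
  have Gpos: "w s + of_nat (Suc k) \<notin> \<int>\<^sub>\<le>\<^sub>0" if "s \<in> U" for s
  proof -
    have "Re (w s + of_nat k) > -1" using that abs_Re_le_cmod[of "w s + of_nat k"] by (auto simp: U_def)
    then have pos: "Re (w s + of_nat (Suc k)) > 0" by simp
    show ?thesis
    proof
      assume "w s + of_nat (Suc k) \<in> \<int>\<^sub>\<le>\<^sub>0"
      then obtain l where "w s + of_nat (Suc k) = - of_nat l" by (rule nonpos_Ints_cases')
      then have "Re (w s + of_nat (Suc k)) = - real l" by simp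
      then show False using pos by simp
    qed
  qed
  have "G holomorphic_on U"
    unfolding G_def by (intro holomorphic_intros) (auto simp: U_def a_poles_def b_poles_def)
  then have h: "h holomorphic_on U"
    unfolding h_def using \<alpha>i poch Gpos
    by (intro holomorphic_intros) (auto simp: w_def[abs_def] pochhammer_prod intro!: holomorphic_intros)
  have eq: "integrand s = h s / (s - s0)" if s: "s \<in> U" "s \<noteq> s0" for s
  proof -
    have "w s \<notin> \<int>\<^sub>\<le>\<^sub>0"
    proof
      assume "w s \<in> \<int>\<^sub>\<le>\<^sub>0"
      then obtain l where l: "w s = - of_nat l" by (auto elim!: nonpos_Ints_cases')
      then have "norm (w s + of_nat k) = \<bar>real k - real l\<bar>"
        by (metis add.commute diff_conv_add_uminus norm_of_real of_real_diff of_real_of_nat_eq)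
      then have "k = l" using s by (auto simp: U_def)
      then show False using l w[of s] s \<alpha>i by simp
    qed
    then have "Gamma (w s) \<noteq> 0" by (simp add: Gamma_eq_zero_iff)
    then have "Gamma (w s) = Gamma (w s + of_nat (Suc k)) / pochhammer (w s) (Suc k)"
      using pochhammer_Gamma[OF \<open>w s \<notin> \<int>\<^sub>\<le>\<^sub>0\<close>, of "Suc k"] Gpos[OF s(1)] by (simp add: Gamma_eq_zero_iff)
    also have "pochhammer (w s) (Suc k) = pochhammer (w s) k * (- of_real (\<alpha> i) * (s - s0))"
      by (simp add: pochhammer_Suc w)
    finally have "Gamma (w s) * G s = h s / (s - s0)"
      by (simp add: h_def divide_inverse mult_ac)
    moreover have "integrand s = Gamma (w s) * G s"
      unfolding foxH_integrand_def foxH_kernel_def G_def using i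
      by (subst prod.remove[of "{1..n}" i]) (simp_all add: w_def)
    ultimately show ?thesis by simp
  qed
  have "residue integrand s0 = residue (\<lambda>s. h s / (s - s0)) s0"
  proof (rule residue_cong)
    show "\<forall>\<^sub>F s in at s0. integrand s = h s / (s - s0)"
      using eventually_at_in_open[OF U s0] by eventually_elim (auto intro: eq)
  qed simp
  also have "\<dots> = h s0" by (rule residue_simple[OF U s0 h])
  also have "w s0 = - of_nat k" using w[of s0] by (simp add: eq_neg_iff_add_eq_0)
  \<comment> \<open>At \<open>w = -k\<close> the Gamma factor is \<open>Gamma 1 = 1\<close> and the
    Pochhammer symbol is \<open>(-1)^k * k!\<close>.\<close>
  then have "h s0 = - (1 / ((- 1) ^ k * fact k)) * G s0 / of_real (\<alpha> i)"
    by (simp add: h_def pochhammer_same)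
  also have "\<dots> = - residue_term i k"
    unfolding foxH_term_def foxH_coeff_def sub ex G_def
    by (cases "even k") (simp_all add: mult_ac)
  finally show ?thesis by (simp add: s0_def)
qed

end

section \<open>Convergence of the series over the poles\<close>

text \<open>Two points of a family with spacing \<open>d i\<close> cannot lie in both halves of an interval of length
  at most \<open>d i\<close>, so each family costs at most a halving of the gap.\<close>

lemma exists_common_gap:
  fixes x :: "'i \<Rightarrow> nat \<Rightarrow> real"
  assumes "finite I" and "\<And>i. i \<in> I \<Longrightarrow> d i > 0"
    and "\<And>i k l. i \<in> I \<Longrightarrow> k \<noteq> l \<Longrightarrow> d i \<le> \<bar>x i k - x i l\<bar>"
  shows "\<exists>e>0. \<forall>y. \<exists>y'\<ge>y. \<forall>i\<in>I. \<forall>k. x i k \<notin> {y'<..<y'+e}"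
  using assms
proof (induction I rule: finite_induct)
  case empty
  show ?case by (intro exI[of _ 1]) auto
next
  case (insert i I)
  then obtain e where e: "e > 0" and gap: "\<And>y. \<exists>y'\<ge>y. \<forall>i\<in>I. \<forall>k. x i k \<notin> {y'<..<y'+e}"
    by (metis insertI2)
  define f where "f = min e (d i)"
  have f: "f > 0" "f \<le> e" "f \<le> d i" using e insert.prems(1)[of i] by (auto simp: f_def)
  have "\<exists>y''\<ge>y. \<forall>j\<in>insert i I. \<forall>k. x j k \<notin> {y''<..<y''+f/2}" for y
  proof -
    obtain y' where y': "y' \<ge> y" "\<And>j k. j \<in> I \<Longrightarrow> x j k \<notin> {y'<..<y'+e}" using gap[of y] by blast
    show ?thesis
    proof (cases "\<exists>k. x i k \<in> {y'<..<y'+f/2}")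
      case False
      then show ?thesis using y' f by (intro exI[of _ y']) fastforce
    next
      case True
      then obtain k where k: "x i k \<in> {y'<..<y'+f/2}" by blast
      have "x i l \<notin> {y'+f/2<..<y'+f/2+f/2}" for l
        using k insert.prems(2)[of i k l] f by (cases "k = l") auto
      moreover have "x j l \<notin> {y'+f/2<..<y'+f/2+f/2}" if "j \<in> I" for j l
        using y'(2)[OF that, of l] f by auto
      ultimately show ?thesis using y' f by (intro exI[of _ "y' + f/2"]) auto
    qed
  qed
  then show ?case using f by (intro exI[of _ "f/2"]) auto
qed

context foxH_convergent begin

text \<open>For a single \<open>i\<close> the real parts of the poles have spacing
  \<open>1 / \<alpha> i\<close>, so gaps of a common width recur arbitrarily far to the right; their
  midpoints serve as abscissas.\<close>

lemma exists_pole_free_abscissas: "\<exists>\<epsilon>>0. \<exists>R. pole_free_abscissas n a \<alpha> \<epsilon> R"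
proof -
  have "1 / \<alpha> i \<le> \<bar>Re (pole i k) - Re (pole i l)\<bar>" if "i \<in> {1..n}" "k \<noteq> l" for i k l
  proof -
    have "Re (pole i k) - Re (pole i l) = (real k - real l) / \<alpha> i"
      using that by (simp add: Re_pole diff_divide_distrib add_divide_distrib)
    moreover have "1 \<le> \<bar>real k - real l\<bar>" using that by linarith
    ultimately show ?thesis using \<alpha>_pos'[OF that(1)] by (simp add: abs_divide divide_right_mono)
  qed
  then have "\<exists>e>0. \<forall>y. \<exists>y'\<ge>y. \<forall>i\<in>{1..n}. \<forall>k. Re (pole i k) \<notin> {y'<..<y'+e}"
    using \<alpha>_pos' by (intro exists_common_gap[where d = "\<lambda>i. 1 / \<alpha> i"]) auto
  then obtain e where e: "e > 0" "\<And>y. \<exists>y'\<ge>y. \<forall>i\<in>{1..n}. \<forall>k. Re (pole i k) \<notin> {y'<..<y'+e}" by blast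
  from e(2) obtain y' where y': "\<And>y. y' y \<ge> y"
    "\<And>y i k. i \<in> {1..n} \<Longrightarrow> Re (pole i k) \<notin> {y' y<..<y' y+e}" by metis
  define R where "R N = y' (real N) + e / 2" for N
  have "filterlim R at_top sequentially"
  proof (rule filterlim_at_top_mono[OF filterlim_real_sequentially])
    show "\<forall>\<^sub>F N in sequentially. real N \<le> R N"
      using y'(1) e(1) by (intro always_eventually allI) (simp add: R_def add_increasing2)
  qed
  moreover have "e / 2 \<le> \<bar>R N - Re (pole i k)\<bar>" if "i \<in> {1..n}" for i k N
    using y'(2)[OF that, of k "real N"] by (auto simp: R_def not_less abs_if)
  ultimately have "pole_free_abscissas n a \<alpha> (e / 2) R" by (auto simp: pole_free_abscissas_def)
  then show ?thesis using e(1) by (intro exI[of _ "e / 2"]) auto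
qed

lemma summable_residue_terms:
  assumes sep: "poles_separated n a \<alpha>" and i: "i \<in> {1..n}"
  shows "summable (residue_term i)"
proof -
  have \<alpha>i: "\<alpha> i > 0" using \<alpha>_pos'[OF i] .
  obtain c K x0 where c: "c > 0" "K > 0" and bound:
    "\<And>k d. Re (pole i k) \<ge> x0 \<Longrightarrow> \<bar>Im (pole i k)\<bar> \<le> \<bar>Im (a i) / \<alpha> i\<bar> \<Longrightarrow> 0 < d \<Longrightarrow> d \<le> 1 \<Longrightarrow>
       (\<And>j l. j \<in> {1..n} - {i} \<Longrightarrow> d \<le> dist (pole i k) (pole j l)) \<Longrightarrow>
       norm (residue_term i k) \<le> K / \<alpha> i / d ^ n * exp (- c * Re (pole i k))"
    using integrand_bounds[of "\<bar>Im (a i) / \<alpha> i\<bar>"] i by metis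
  \<comment> \<open>The separation rate is chosen so that the loss \<open>d^(-n)\<close>, of size
    \<open>exp (n * c' * k)\<close>, uses up at most half of the decay
    \<open>exp (- (c / \<alpha> i) * k)\<close>.\<close>
  define c' where "c' = c / (2 * \<alpha> i * (real n + 1))"
  have "c' > 0" using c \<alpha>i by (simp add: c'_def)
  have nc': "real n * c' \<le> c / (2 * \<alpha> i)"
    using c \<alpha>i by (simp add: c'_def divide_simps)
  obtain C where C: "C > 0" "\<And>j k l. j \<in> {1..n} \<Longrightarrow> i \<noteq> j \<Longrightarrow> C * exp (- c' * real k) \<le> dist (pole i k) (pole j l)"
    using sep \<open>c' > 0\<close> i unfolding poles_separated_def by metis
  \<comment> \<open>\<open>integrand_bounds\<close> requires \<open>d \<le> 1\<close>.\<close>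
  define D where "D = min C 1"
  have D: "D > 0" "D \<le> 1" "D \<le> C" using C(1) by (auto simp: D_def)
  define K' where "K' = K / \<alpha> i / D ^ n * exp (- c * (1 - Re (a i)) / \<alpha> i)"
  have "K' > 0" using c \<alpha>i D by (simp add: K'_def)
  have "\<forall>\<^sub>F k in sequentially. norm (residue_term i k) \<le> K' * exp (- (c / (2 * \<alpha> i))) ^ k"
    using eventually_ge_at_top[of "nat \<lceil>\<alpha> i * x0 + Re (a i) - 1\<rceil>"]
  proof eventually_elim
    case (elim k)
    define d where "d = D * exp (- c' * real k)"
    have "norm (residue_term i k) \<le> K / \<alpha> i / d ^ n * exp (- c * Re (pole i k))"
    proof (rule bound)
      show "x0 \<le> Re (pole i k)" using elim Re_pole_less_iff[OF i, of k x0] by linarith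
      show "0 < d" using D by (simp add: d_def)
      show "d \<le> 1" using D \<open>c' > 0\<close> by (simp add: d_def mult_le_one)
      show "d \<le> dist (pole i k) (pole j l)" if "j \<in> {1..n} - {i}" for j l
      proof -
        have "d \<le> C * exp (- c' * real k)" unfolding d_def using D(3) by (rule mult_right_mono) simp
        also have "\<dots> \<le> dist (pole i k) (pole j l)" using C(2) that by auto
        finally show ?thesis .
      qed
    qed (simp add: Im_pole[OF i])
    also have "\<dots> = K' * exp (real n * c' * real k - c / \<alpha> i * real k)"
    proof -
      have E1: "exp (- c * Re (pole i k)) = exp (- c * (1 - Re (a i)) / \<alpha> i) * exp (- (c / \<alpha> i * real k))"
        unfolding mult_exp_exp using \<alpha>i by (simp add: Re_pole[OF i] field_simps)
      have E2: "1 / d ^ n = 1 / D ^ n * exp (real n * c' * real k)"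
        by (simp add: d_def power_mult_distrib exp_minus exp_of_nat_mult[symmetric] field_simps mult_ac)
      have "K / \<alpha> i / d ^ n * exp (- c * Re (pole i k)) = K / \<alpha> i * (1 / d ^ n) * exp (- c * Re (pole i k))"
        by simp
      also have "\<dots> = K' * (exp (real n * c' * real k) * exp (- (c / \<alpha> i * real k)))"
        unfolding E1 E2 K'_def by (simp add: mult_ac)
      finally show ?thesis by (simp add: mult_exp_exp)
    qed
    also have "\<dots> \<le> K' * exp (- (c / (2 * \<alpha> i)) * real k)"
    proof -
      have "real n * c' * real k \<le> c / (2 * \<alpha> i) * real k" using nc' by (intro mult_right_mono) auto
      moreover have "c / \<alpha> i * real k = c / (2 * \<alpha> i) * real k + c / (2 * \<alpha> i) * real k"
        using \<alpha>i by (simp add: field_simps)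
      ultimately show ?thesis using \<open>K' > 0\<close> by simp
    qed
    also have "exp (- (c / (2 * \<alpha> i)) * real k) = exp (- (c / (2 * \<alpha> i))) ^ k"
      by (simp add: exp_of_nat_mult[symmetric] mult.commute)
    finally show ?case .
  qed
  moreover have "summable (\<lambda>k. K' * exp (- (c / (2 * \<alpha> i))) ^ k)"
    using c \<alpha>i by (intro summable_mult summable_geometric) simp
  ultimately show ?thesis by (rule summable_comparison_test_ev)
qed

text \<open>For each \<open>i\<close> the condition on the real part cuts out an initial segment of
  indices, whose length tends to infinity with \<open>R N\<close>.\<close>

lemma residue_sums_tendsto:
  assumes R: "filterlim R at_top sequentially"
    and sum: "\<And>i. i \<in> {1..n} \<Longrightarrow> summable (residue_term i)"
  shows "(\<lambda>N. \<Sum>i=1..n. \<Sum>k | Re (pole i k) < R N. residue_term i k) \<longlonglongrightarrow> (\<Sum>i=1..n. \<Sum>k. residue_term i k)"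
proof (intro tendsto_sum)
  fix i assume i: "i \<in> {1..n}"
  define f where "f N = nat \<lceil>\<alpha> i * R N + Re (a i) - 1\<rceil>" for N
  have "filterlim f at_top sequentially"
    unfolding filterlim_at_top
  proof
    fix Z
    have "\<forall>\<^sub>F N in sequentially. (real Z - Re (a i) + 1) / \<alpha> i \<le> R N"
      using R by (simp add: filterlim_at_top)
    then show "\<forall>\<^sub>F N in sequentially. Z \<le> f N"
    proof eventually_elim
      case (elim N)
      then have "real Z \<le> \<alpha> i * R N + Re (a i) - 1" using \<alpha>_pos'[OF i] by (simp add: field_simps)
      then show ?case unfolding f_def by linarith
    qed
  qed
  from filterlim_compose[OF summable_LIMSEQ[OF sum[OF i]] this]
  show "(\<lambda>N. \<Sum>k | Re (pole i k) < R N. residue_term i k) \<longlonglongrightarrow> (\<Sum>k. residue_term i k)"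
    by (simp add: poles_below_eq[OF i] f_def)
qed

end

section \<open>Expansion of the H-function\<close>

locale foxH_setting = foxH_convergent + loop +
  assumes b_outside: "j \<in> {1..m} \<Longrightarrow> b j + of_real (\<beta> j) * s \<in> \<int>\<^sub>\<le>\<^sub>0 \<Longrightarrow> s \<in> outside_loop \<phi>1 \<phi>2 X g"
    and a_inside: "i \<in> {1..n} \<Longrightarrow> 1 - a i - of_real (\<alpha> i) * s \<in> \<int>\<^sub>\<le>\<^sub>0 \<Longrightarrow> s \<in> inside_loop \<phi>1 \<phi>2 X g"

context foxH_setting begin

lemma a_pole_inside: "i \<in> {1..n} \<Longrightarrow> pole i k \<in> inside_loop \<phi>1 \<phi>2 X g"
  using a_inside[of i "pole i k"] a_poles_eq[of i] by (metis (mono_tags) a_poles_def mem_Collect_eq rangeI)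

lemma b_pole_outside: "j \<in> {1..m} \<Longrightarrow> s \<in> b_poles j \<Longrightarrow> s \<in> outside_loop \<phi>1 \<phi>2 X g"
  using b_outside by (auto simp: b_poles_def)

lemma singularity_cases:
  assumes "s \<in> singularities"
  obtains (a) i k where "i \<in> {1..n}" "s = pole i k" | (b) j where "j \<in> {1..m}" "s \<in> b_poles j"
  using assms a_poles_eq by (fastforce simp: singularities_def)

lemma pole_in_singularities: "i \<in> {1..n} \<Longrightarrow> pole i k \<in> singularities"
  using a_poles_eq by (fastforce simp: singularities_def)

lemma singularity_off_loop: "s \<in> singularities \<Longrightarrow> s \<in> inside_loop \<phi>1 \<phi>2 X g \<or> s \<in> outside_loop \<phi>1 \<phi>2 X g"
  by (elim singularity_cases) (auto intro: a_pole_inside b_pole_outside)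

lemma closed_loop_avoids:
  assumes R: "xmax < R" and free: "\<And>s. s \<in> singularities \<Longrightarrow> Re s \<noteq> R"
  shows "path_image (closed_loop R) \<subseteq> - singularities"
proof
  fix s assume s: "s \<in> path_image (closed_loop R)"
  have "Re s \<le> R"
    using Re_le_closed_loop[OF _ s] R by simp
  then show "s \<in> - singularities"
    using s R free[of s] singularity_off_loop[of s] winding_number_inside_loop(1)[of s R]
      winding_number_outside_loop(1)[of s R] by force
qed

text \<open>The sign of the clockwise winding number cancels the sign in
  \<open>residue_integrand\<close>. Poles beyond \<open>R\<close> and those of the factors with
  \<open>b j\<close> have winding number 0.\<close>

lemma contour_integral_closed_loop_residues:
  assumes R: "xmax < R" and free: "\<And>s. s \<in> singularities \<Longrightarrow> Re s \<noteq> R"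
  shows "contour_integral (closed_loop R) integrand =
     2 * pi * \<i> * (\<Sum>i=1..n. \<Sum>k | Re (pole i k) < R. residue_term i k)"
proof -
  note avoid = closed_loop_avoids[OF assms]
  have "bounded (path_image (closed_loop R))"
    using valid_closed_loop by (intro bounded_path_image valid_path_imp_path)
  then obtain B where B: "\<And>s. s \<in> path_image (closed_loop R) \<Longrightarrow> norm s < B"
    by (metis bounded_pos_less)
  \<comment> \<open>An open convex strip around the closed loop: it contains only finitely many
    singularities, and the winding number vanishes off it by convexity.\<close>
  define S where "S = {s. - B < Re s \<and> Re s < R + 1}"
  define pts where "pts = singularities \<inter> S"
  define T where "T = (SIGMA i:{1..n}. {k. Re (pole i k) < R})"
  let ?wn = "winding_number (closed_loop R)"
  have S: "open S" "convex S"
  proof -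
    have "S = {s. - B < Re s} \<inter> {s. Re s < R + 1}" by (auto simp: S_def)
    then show "open S" "convex S"
      by (auto intro!: open_Int convex_Int open_halfspace_Re_gt open_halfspace_Re_lt
         convex_halfspace_Re_gt convex_halfspace_Re_lt)
  qed
  have img: "path_image (closed_loop R) \<subseteq> S"
  proof
    fix s assume s: "s \<in> path_image (closed_loop R)"
    then have "Re s \<le> R"
      using Re_le_closed_loop[of R s] R by simp
    moreover have "- B < Re s" using B[OF s] abs_Re_le_cmod[of s] by linarith
    ultimately show "s \<in> S" by (simp add: S_def)
  qed
  have fin: "finite pts" using finite_singularities[of B "R + 1"] by (simp add: pts_def S_def)
  have zero: "\<forall>z. z \<notin> S \<longrightarrow> ?wn z = 0"
    using winding_number_zero_outside[OF _ S(2) _ _ img] valid_closed_loop by (auto simp: valid_path_imp_path)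
  have wn_T: "?wn (pole i k) = -1" "pole i k \<in> pts" if "(i, k) \<in> T" for i k
  proof -
    from that have i: "i \<in> {1..n}" and "Re (pole i k) < R" by (auto simp: T_def)
    then show "?wn (pole i k) = -1"
      using winding_number_inside_loop(2)[OF a_pole_inside[OF i] R] by blast
    \<comment> \<open>Off \<open>S\<close> the winding number would be 0, not -1.\<close>
    then have "pole i k \<in> S" using zero by force
    then show "pole i k \<in> pts" using pole_in_singularities[OF i] by (simp add: pts_def)
  qed
  have wn_other: "?wn s = 0" if s: "s \<in> pts - (\<lambda>(i, k). pole i k) ` T" for s
  proof (cases "Re s < R")
    case False
    then have "R < Re s" using s free[of s] by (auto simp: pts_def)
    then show ?thesis using winding_number_closed_loop_right[of R s] R by simp
  next
    case True
    from s have "s \<in> singularities" by (simp add: pts_def)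
    then show ?thesis
    proof (cases s rule: singularity_cases)
      case (a i k)
      then have "(i, k) \<in> T" using True by (simp add: T_def)
      then show ?thesis using s a by force
    next
      case (b j)
      then show ?thesis using winding_number_outside_loop(2)[OF b_pole_outside[OF b] R True] by simp
    qed
  qed
  have "contour_integral (closed_loop R) integrand = 2 * pi * \<i> * (\<Sum>s\<in>pts. ?wn s * residue integrand s)"
  proof (rule Residue_theorem[OF S(1) convex_connected[OF S(2)] fin])
    show "integrand holomorphic_on S - pts"
      by (rule holomorphic_on_subset[OF integrand_holomorphic]) (auto simp: pts_def)
    show "path_image (closed_loop R) \<subseteq> S - pts" using img avoid by (auto simp: pts_def)
  qed (use valid_closed_loop zero in auto)
  also have "(\<Sum>s\<in>pts. ?wn s * residue integrand s) = (\<Sum>s\<in>(\<lambda>(i, k). pole i k) ` T. ?wn s * residue integrand s)"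
    using fin wn_other wn_T(2) by (intro sum.mono_neutral_right) auto
  also have "\<dots> = (\<Sum>(i, k)\<in>T. ?wn (pole i k) * residue integrand (pole i k))"
    by (subst sum.reindex) (auto simp: inj_on_def T_def pole_eq_iff case_prod_unfold)
  also have "\<dots> = (\<Sum>(i, k)\<in>T. residue_term i k)"
    using wn_T(1) by (intro sum.cong) (auto simp: residue_integrand T_def)
  also have "\<dots> = (\<Sum>i=1..n. \<Sum>k | Re (pole i k) < R. residue_term i k)"
    unfolding T_def by (subst sum.Sigma[symmetric]) (auto simp: poles_below_eq)
  finally show ?thesis .
qed

section \<open>Integrability along the loop and decay of the vertical segments\<close>

lemma half_line_integrable:
  assumes \<phi>: "\<phi> \<in> {\<phi>1, \<phi>2}"
  shows "set_integrable lborel {X..} (\<lambda>x. integrand (Complex x \<phi>))"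
proof -
  have "\<phi> \<noteq> Im (pole i 0)" if i: "i \<in> {1..n}" for i
  proof -
    \<comment> \<open>All poles of index \<open>i\<close> lie on one horizontal line. If it carried
      the half-line, a pole with \<open>k\<close> this large would lie on the loop.\<close>
    define k where "k = nat \<lceil>\<alpha> i * X + Re (a i) - 1\<rceil>"
    have "\<not> Re (pole i k) < X" using Re_pole_less_iff[OF i, of k X] by (simp add: k_def)
    then have "Im (pole i k) \<noteq> \<phi>"
      using not_on_loop(2,3)[of "pole i k"] a_pole_inside[OF i, of k] \<phi> by auto
    then show ?thesis by (simp add: Im_pole[OF i])
  qed
  \<comment> \<open>Hence the half-line keeps a positive distance from all poles. The inserted 1
    gives \<open>d \<le> 1\<close> and covers \<open>n = 0\<close>.\<close>
  define d where "d = Min (insert 1 ((\<lambda>i. \<bar>\<phi> - Im (pole i 0)\<bar>) ` {1..n}))"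
  have d: "0 < d" "d \<le> 1"
    using \<open>\<And>i. i \<in> {1..n} \<Longrightarrow> \<phi> \<noteq> Im (pole i 0)\<close> unfolding d_def by (auto simp: Min_gr_iff)
  have dist: "d \<le> dist (Complex x \<phi>) (pole i k)" if i: "i \<in> {1..n}" for x i k
  proof -
    have "d \<le> \<bar>\<phi> - Im (pole i 0)\<bar>" unfolding d_def using i by (intro Min_le) auto
    also have "\<dots> = \<bar>Im (Complex x \<phi> - pole i k)\<bar>" by (simp add: Im_pole[OF i])
    also have "\<dots> \<le> dist (Complex x \<phi>) (pole i k)" unfolding dist_norm by (rule abs_Im_le_cmod)
    finally show ?thesis .
  qed
  obtain c K x0 where c: "c > 0" and bound:
    "\<And>s d. Re s \<ge> x0 \<Longrightarrow> \<bar>Im s\<bar> \<le> \<bar>\<phi>\<bar> \<Longrightarrow> 0 < d \<Longrightarrow> d \<le> 1 \<Longrightarrow>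
       (\<And>i k. i \<in> {1..n} \<Longrightarrow> d \<le> dist s (pole i k)) \<Longrightarrow> norm (integrand s) \<le> K / d ^ n * exp (- c * Re s)"
    using integrand_bounds[of "\<bar>\<phi>\<bar>"] by metis
  show ?thesis
  proof (rule set_integrable_exp_bound[OF _ c])
    show "norm (integrand (Complex x \<phi>)) \<le> K / d ^ n * exp (- c * x)" if "x \<ge> x0" for x
      using bound[of "Complex x \<phi>" d] dist d that by simp
    have "Complex x \<phi> \<notin> singularities" if "x \<ge> X" for x
      using singularity_off_loop[of "Complex x \<phi>"] not_on_loop(2,3)[of "Complex x \<phi>"] that \<phi> by auto
    moreover have "continuous_on {X..} (\<lambda>x. Complex x \<phi>)"
      unfolding Complex_eq by (intro continuous_intros)
    ultimately show "continuous_on {X..} (\<lambda>x. integrand (Complex x \<phi>))"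
      by (intro continuous_on_compose2[OF holomorphic_on_imp_continuous_on[OF integrand_holomorphic]]) auto
  qed
qed

lemma foxH_loop_integrable: "loop_integrable integrand \<phi>1 \<phi>2 X g"
proof -
  have "path_image g \<subseteq> - singularities" using singularity_off_loop not_on_loop(1) by blast
  then have "integrand contour_integrable_on g"
    by (rule contour_integrable_holomorphic_simple[OF integrand_holomorphic open_regular valid_g])
  then show ?thesis unfolding loop_integrable_def using half_line_integrable by auto
qed

text \<open>The segments have constant length and lie in a fixed strip at distance at least
  \<epsilon> from the poles, so the decay of the integrand is inherited with constants independent
  of \<open>R\<close>.\<close>

lemma vertical_integral_le:
  assumes "\<epsilon> > 0"
  obtains c K x0 where "c > 0"
    "\<And>R. R \<ge> x0 \<Longrightarrow> (\<And>i k. i \<in> {1..n} \<Longrightarrow> \<epsilon> \<le> \<bar>R - Re (pole i k)\<bar>) \<Longrightarrow>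
       (\<And>s. s \<in> singularities \<Longrightarrow> Re s \<noteq> R) \<Longrightarrow>
       norm (contour_integral (linepath (Complex R \<phi>1) (Complex R \<phi>2)) integrand) \<le> K * exp (- c * R)"
proof -
  define M where "M = max \<bar>\<phi>1\<bar> \<bar>\<phi>2\<bar>"
  define d where "d = min \<epsilon> 1"
  have d: "0 < d" "d \<le> 1" "d \<le> \<epsilon>" using assms by (auto simp: d_def)
  obtain c K x0 where c: "c > 0" "K > 0" and bound:
    "\<And>s d. Re s \<ge> x0 \<Longrightarrow> \<bar>Im s\<bar> \<le> M \<Longrightarrow> 0 < d \<Longrightarrow> d \<le> 1 \<Longrightarrow>
       (\<And>i k. i \<in> {1..n} \<Longrightarrow> d \<le> dist s (pole i k)) \<Longrightarrow> norm (integrand s) \<le> K / d ^ n * exp (- c * Re s)"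
    using integrand_bounds[of M] by metis
  show ?thesis
  proof (rule that[OF c(1)])
    fix R assume R: "R \<ge> x0" "\<And>i k. i \<in> {1..n} \<Longrightarrow> \<epsilon> \<le> \<bar>R - Re (pole i k)\<bar>" and free: "\<And>s. s \<in> singularities \<Longrightarrow> Re s \<noteq> R"
    let ?l = "linepath (Complex R \<phi>1) (Complex R \<phi>2)"
    have "norm (contour_integral ?l integrand) \<le> K / d ^ n * exp (- c * R) * norm (Complex R \<phi>2 - Complex R \<phi>1)"
    proof (rule contour_integral_bound_linepath)
      show "integrand contour_integrable_on ?l"
        using free by (intro contour_integrable_holomorphic_simple[OF integrand_holomorphic open_regular])
          (auto simp: mem_vertical_segment)
      show "0 \<le> K / d ^ n * exp (- c * R)" using c d by simp
      fix s assume "s \<in> closed_segment (Complex R \<phi>1) (Complex R \<phi>2)"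
      then have s: "Re s = R" "Im s \<in> {\<phi>1..\<phi>2}"
        using \<phi>_less by (auto simp: mem_vertical_segment closed_segment_eq_real_ivl)
      have "d \<le> dist s (pole i k)" if i: "i \<in> {1..n}" for i k
      proof -
        have "d \<le> \<bar>Re (s - pole i k)\<bar>" using R(2)[OF i, of k] d(3) s by simp
        also have "\<dots> \<le> dist s (pole i k)" unfolding dist_norm by (rule abs_Re_le_cmod)
        finally show ?thesis .
      qed
      then show "norm (integrand s) \<le> K / d ^ n * exp (- c * R)"
        using bound[of s d] R(1) s d by (auto simp: M_def)
    qed
    also have "norm (Complex R \<phi>2 - Complex R \<phi>1) = \<phi>2 - \<phi>1"
      using \<phi>_less by (simp add: cmod_def)
    finally show "norm (contour_integral ?l integrand) \<le> (K / d ^ n * (\<phi>2 - \<phi>1)) * exp (- c * R)"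
      by (simp add: mult_ac)
  qed
qed

text \<open>Along the abscissas \<open>R N\<close> the partial sums equal the truncated loop
  integrals up to the vertical integral, which tends to 0; the truncated half-line integrals
  converge by integrability.\<close>

lemma foxH_tendsto:
  assumes \<epsilon>: "\<epsilon> > 0" and R: "pole_free_abscissas n a \<alpha> \<epsilon> R"
  shows "(\<lambda>N. \<Sum>i=1..n. \<Sum>k | Re (pole i k) < R N. residue_term i k) \<longlonglongrightarrow> foxH m n p q a \<alpha> b \<beta> \<phi>1 \<phi>2 X g L"
proof -
  have lim: "filterlim R at_top sequentially" and dist: "\<And>N i k. i \<in> {1..n} \<Longrightarrow> \<epsilon> \<le> \<bar>R N - Re (pole i k)\<bar>"
    using R by (auto simp: pole_free_abscissas_def)
  obtain c K x0 where c: "c > 0" and vert: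
    "\<And>R. R \<ge> x0 \<Longrightarrow> (\<And>i k. i \<in> {1..n} \<Longrightarrow> \<epsilon> \<le> \<bar>R - Re (pole i k)\<bar>) \<Longrightarrow>
       (\<And>s. s \<in> singularities \<Longrightarrow> Re s \<noteq> R) \<Longrightarrow>
       norm (contour_integral (linepath (Complex R \<phi>1) (Complex R \<phi>2)) integrand) \<le> K * exp (- c * R)"
    using vertical_integral_le[OF \<epsilon>] by metis
  \<comment> \<open>Beyond \<open>x1\<close> there are no poles of the factors with
    \<open>b j\<close>, so the distance condition on the abscissas excludes all
    singularities.\<close>
  obtain x1 where x1: "\<And>s j. Re s \<ge> x1 \<Longrightarrow> j \<in> {1..q} \<Longrightarrow> Re (b j + of_real (\<beta> j) * s) > 0"
    using eventually_regular unfolding eventually_at_top_linorder by blast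
  have free: "Re s \<noteq> R N" if N: "x1 \<le> R N" and "s \<in> singularities" for s N
    using that(2)
  proof (cases s rule: singularity_cases)
    case (a i k)
    then show ?thesis using dist[OF a(1), of N k] \<epsilon> by auto
  next
    case (b j)
    show ?thesis
    proof
      assume "Re s = R N"
      then have "Re (b j + of_real (\<beta> j) * s) > 0" using x1[of s j] N b mq by auto
      moreover obtain l where "b j + of_real (\<beta> j) * s = - of_nat l"
        using b by (auto simp: b_poles_def elim!: nonpos_Ints_cases')
      then have "Re (b j + of_real (\<beta> j) * s) = - real l" by simp
      ultimately show False by simp
    qed
  qed
  let ?V = "\<lambda>N. contour_integral (linepath (Complex (R N) \<phi>1) (Complex (R N) \<phi>2)) integrand"
  let ?I = "\<lambda>\<phi> A. LINT t:A|lborel. integrand (Complex t \<phi>)"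
  have large: "\<forall>\<^sub>F N in sequentially. xmax < R N \<and> x0 \<le> R N \<and> x1 \<le> R N"
  proof (intro eventually_conj)
    show "\<forall>\<^sub>F N in sequentially. xmax < R N" using lim by (simp add: filterlim_at_top_dense)
  qed (use lim in \<open>auto simp: filterlim_at_top\<close>)
  have V: "?V \<longlonglongrightarrow> 0"
  proof (rule tendsto_norm_zero_cancel, rule tendsto_sandwich[OF _ _ tendsto_const])
    show "\<forall>\<^sub>F N in sequentially. norm (?V N) \<le> K * exp (- c * R N)"
      using large by eventually_elim (rule vert, auto dest: free intro: dist)
    have "((\<lambda>x. K * exp (- c * x)) \<longlongrightarrow> 0) at_top" using c by real_asymp
    then show "(\<lambda>N. K * exp (- c * R N)) \<longlonglongrightarrow> 0" using lim by (rule filterlim_compose)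
  qed auto
  have I: "(\<lambda>N. ?I \<phi> {X..R N}) \<longlonglongrightarrow> ?I \<phi> {X..}" if "\<phi> \<in> {\<phi>1, \<phi>2}" for \<phi>
    by (rule filterlim_compose[OF tendsto_set_lebesgue_integral_at_top[OF _ half_line_integrable[OF that]] lim]) auto
  have "(\<lambda>N. 1 / (2 * of_real pi * \<i>) * (- ?I \<phi>1 {X..R N} + contour_integral g integrand + ?I \<phi>2 {X..R N} - ?V N))
      \<longlonglongrightarrow> 1 / (2 * of_real pi * \<i>) * (- ?I \<phi>1 {X..} + contour_integral g integrand + ?I \<phi>2 {X..} - 0)"
    by (intro tendsto_intros I V) auto
  moreover have "\<forall>\<^sub>F N in sequentially. (\<Sum>i=1..n. \<Sum>k | Re (pole i k) < R N. residue_term i k) =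
      1 / (2 * of_real pi * \<i>) * (- ?I \<phi>1 {X..R N} + contour_integral g integrand + ?I \<phi>2 {X..R N} - ?V N)"
    using large
  proof eventually_elim
    case (elim N)
    have "2 * pi * \<i> * (\<Sum>i=1..n. \<Sum>k | Re (pole i k) < R N. residue_term i k) =
        - ?I \<phi>1 {X..R N} + contour_integral g integrand + ?I \<phi>2 {X..R N} - ?V N"
      using elim free contour_integral_closed_loop_residues[of "R N"]
        contour_integral_closed_loop[OF _ integrand_holomorphic open_regular closed_loop_avoids, of "R N"]
      by auto
    then show ?case by (simp add: field_simps)
  qed
  ultimately show ?thesis
    unfolding foxH_def loop_integral_def by (simp add: tendsto_cong)
qed

end

text \<open>Near-coincident poles of different indices can make an inner series diverge, so the
  iterated sum is stated under summability, for which separation of the poles suffices, while the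
  limit over pole-free vertical lines holds in every case.\<close>

theorem theorem4:
  fixes m n p q :: nat
    and a b :: "nat \<Rightarrow> complex" and \<alpha> \<beta> :: "nat \<Rightarrow> real"
    and z L :: complex
    and \<phi>1 \<phi>2 X :: real and g :: "real \<Rightarrow> complex"
  assumes "m \<le> q" and "n \<le> p"
    and "\<And>i. i \<in> {1..p} \<Longrightarrow> \<alpha> i > 0"
    and "\<And>j. j \<in> {1..q} \<Longrightarrow> \<beta> j > 0"
    and "\<And>i j (k::nat) (l::nat). i \<in> {1..n} \<Longrightarrow> j \<in> {1..m} \<Longrightarrow>
           of_real (\<beta> j) * (a i - 1 - of_nat k) \<noteq> of_real (\<alpha> i) * (b j + of_nat l)"
    and "\<And>i j (k::nat) (l::nat). i \<in> {1..n} \<Longrightarrow> j \<in> {1..n} \<Longrightarrow> i \<noteq> j \<Longrightarrow>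
           of_real (\<alpha> j) * (1 - a i + of_nat k) \<noteq> of_real (\<alpha> i) * (1 - a j + of_nat l)"
    and "foxH_Delta p q \<alpha> \<beta> < 0 \<and> z \<noteq> 0 \<or>
         foxH_Delta p q \<alpha> \<beta> = 0 \<and> norm z > foxH_delta p q \<alpha> \<beta>"
    and "exp L = z"
    and "foxH_loop m n a \<alpha> b \<beta> \<phi>1 \<phi>2 X g"
  shows "loop_integrable (foxH_integrand m n p q a \<alpha> b \<beta> L) \<phi>1 \<phi>2 X g \<and>
         ((\<forall>i\<in>{1..n}. summable (\<lambda>k. foxH_term m n p q a \<alpha> b \<beta> L i k)) \<longrightarrow>
            foxH m n p q a \<alpha> b \<beta> \<phi>1 \<phi>2 X g L =
              (\<Sum>i=1..n. \<Sum>k. foxH_term m n p q a \<alpha> b \<beta> L i k)) \<and>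
         (poles_separated n a \<alpha> \<longrightarrow>
            (\<forall>i\<in>{1..n}. summable (\<lambda>k. foxH_term m n p q a \<alpha> b \<beta> L i k))) \<and>
         sums_over_poles n a \<alpha> (foxH_term m n p q a \<alpha> b \<beta> L)
           (foxH m n p q a \<alpha> b \<beta> \<phi>1 \<phi>2 X g L)"
proof -
  interpret foxH_setting m n p q a b \<alpha> \<beta> L \<phi>1 \<phi>2 X g
    using assms by unfold_locales (auto simp: foxH_loop_def)
  obtain \<epsilon> R where R: "\<epsilon> > 0" "pole_free_abscissas n a \<alpha> \<epsilon> R"
    using exists_pole_free_abscissas by blast
  have "foxH m n p q a \<alpha> b \<beta> \<phi>1 \<phi>2 X g L = (\<Sum>i=1..n. \<Sum>k. residue_term i k)"
    if "\<forall>i\<in>{1..n}. summable (residue_term i)"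
    \<comment> \<open>Along one admissible sequence the same partial sums tend both to the
      H-function and to the iterated series.\<close>
    using foxH_tendsto[OF R] R(2) residue_sums_tendsto[of R] that
    by (intro LIMSEQ_unique[OF foxH_tendsto[OF R]] residue_sums_tendsto) (auto simp: pole_free_abscissas_def)
  moreover have "sums_over_poles n a \<alpha> residue_term (foxH m n p q a \<alpha> b \<beta> \<phi>1 \<phi>2 X g L)"
    unfolding sums_over_poles_def using exists_pole_free_abscissas foxH_tendsto by blast
  ultimately show ?thesis using foxH_loop_integrable summable_residue_terms by auto
qed

end
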